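(* Let $(S,+)$ be a commutative semigroup and $A\subseteq S$. If $d^*(A)>0$, then $A$ is combinatorially rich.
   Context: $d^*(A)=\sup\{\lambda(\mathbb{1}_A)\}$ over all translation invariant means $\lambda$ on $(S,+)$ (positive linear functionals of norm $1$ on bounded real functions with $\lambda(x\mapsto f(s+x))=\lambda(f)$ for all $s$); if no such means exist the supremum is $-\infty$. For $\mathbf{M}=(M_{i,j})\in S^{r\times n}$ and nonempty $\alpha\subseteq\{1,\dots,r\}$, $M_{\alpha,j}=\sum_{i\in\alpha}M_{i,j}$. $A$ is combinatorially rich if for every $n\in\mathbb{N}$ there is $r\in\mathbb{N}$ such that for every $\mathbf{M}\in S^{r\times n}$ there exist a nonempty $\alpha\subseteq\{1,\dots,r\}$ and $s\in S$ with $s+M_{\alpha,j}\in A$ for all $j\in\{1,\dots,n\}$. *)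

theory Defs
  imports "HOL-Analysis.Analysis"
begin

text \<open>
  Functionals on the space of bounded real functions on \<open>'a\<close> are represented by maps
  \<open>L :: ('a \<Rightarrow> real) \<Rightarrow> real\<close> of which only the values at bounded functions matter.
\<close>

definition bounded_functions :: "('a \<Rightarrow> real) set" where
  "bounded_functions = {f. bounded (range f)}"

definition linear_functional :: "(('a \<Rightarrow> real) \<Rightarrow> real) \<Rightarrow> bool" where
  "linear_functional L \<longleftrightarrow>
     (\<forall>f\<in>bounded_functions. \<forall>g\<in>bounded_functions. L (\<lambda>x. f x + g x) = L f + L g) \<and>
     (\<forall>c. \<forall>f\<in>bounded_functions. L (\<lambda>x. c * f x) = c * L f)"

definition positive_functional :: "(('a \<Rightarrow> real) \<Rightarrow> real) \<Rightarrow> bool" where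
  "positive_functional L \<longleftrightarrow> (\<forall>f\<in>bounded_functions. (\<forall>x. 0 \<le> f x) \<longrightarrow> 0 \<le> L f)"

text \<open>Operator norm with respect to the supremum norm; \<open>\<infinity>\<close> if the functional is unbounded.\<close>

definition functional_norm :: "(('a \<Rightarrow> real) \<Rightarrow> real) \<Rightarrow> ereal" where
  "functional_norm L = (SUP f\<in>{f\<in>bounded_functions. \<forall>x. \<bar>f x\<bar> \<le> 1}. ereal \<bar>L f\<bar>)"

definition translation_invariant :: "(('a::ab_semigroup_add \<Rightarrow> real) \<Rightarrow> real) \<Rightarrow> bool" where
  "translation_invariant L \<longleftrightarrow> (\<forall>s. \<forall>f\<in>bounded_functions. L (\<lambda>x. f (s + x)) = L f)"

definition invariant_means :: "(('a::ab_semigroup_add \<Rightarrow> real) \<Rightarrow> real) set" where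
  "invariant_means =
     {L. linear_functional L \<and> positive_functional L \<and> functional_norm L = 1 \<and>
         translation_invariant L}"

text \<open>The supremum is taken in \<^typ>\<open>ereal\<close>, so that it is \<open>-\<infinity>\<close> over the empty set.\<close>

definition upper_Banach_density :: "'a::ab_semigroup_add set \<Rightarrow> ereal" where
  "upper_Banach_density A = (SUP L\<in>invariant_means. ereal (L (indicator A)))"

text \<open>
  A semigroup need not have a neutral element, so \<^const>\<open>sum\<close> is unavailable.  The sum over a
  finite nonempty index set starts from the term at the least index; the value at empty or
  infinite sets is irrelevant.
\<close>

definition semigroup_sum :: "(nat \<Rightarrow> 'a::ab_semigroup_add) \<Rightarrow> nat set \<Rightarrow> 'a" where
  "semigroup_sum f I = Finite_Set.fold (\<lambda>i s. f i + s) (f (Min I)) (I - {Min I})"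

lemma comp_fun_commute_add: "comp_fun_commute (\<lambda>i (s::'a::ab_semigroup_add). f i + s)"
  by unfold_locales (simp add: fun_eq_iff add.left_commute)

lemma semigroup_sum_singleton [simp]: "semigroup_sum f {i} = f i"
  by (simp add: semigroup_sum_def)

lemma semigroup_sum_insert:
  assumes "finite I" "I \<noteq> {}" "i \<notin> I"
  shows "semigroup_sum f (insert i I) = f i + semigroup_sum f I"
proof -
  interpret comp_fun_commute "\<lambda>i s. f i + s" by (rule comp_fun_commute_add)
  define m where "m = Min I"
  have m: "m \<in> I" using assms by (simp add: m_def)
  have swap: "f b + Finite_Set.fold (\<lambda>i s. f i + s) (f a) K =
              f a + Finite_Set.fold (\<lambda>i s. f i + s) (f b) K" if "finite K" for a b K
    using that
  proof (induction K)
    case empty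
    show ?case by (simp add: add.commute[of "f b"])
  next
    case (insert x K)
    then show ?case by (simp add: add.left_commute[of _ "f x"])
  qed
  show ?thesis
  proof (cases "i < m")
    case True
    then have M: "Min (insert i I) = i" using assms m_def by (simp add: Min_insert min_absorb1 del: Min_less_iff Min_gr_iff)
    have "semigroup_sum f (insert i I) = Finite_Set.fold (\<lambda>i s. f i + s) (f i) I"
      using assms by (simp add: semigroup_sum_def M)
    also have "\<dots> = f m + Finite_Set.fold (\<lambda>i s. f i + s) (f i) (I - {m})"
      using assms m by (simp add: fold_rec)
    also have "\<dots> = f i + semigroup_sum f I"
      using swap[of "I - {m}" m i] assms by (simp add: semigroup_sum_def m_def)
    finally show ?thesis .
  next
    case False
    then have M: "Min (insert i I) = m" using assms m_def by (simp add: Min_insert min_absorb2 del: Min_less_iff Min_gr_iff)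
    have "insert i I - {m} = insert i (I - {m})" using m assms by auto
    then show ?thesis using assms M by (simp add: semigroup_sum_def m_def)
  qed
qed

lemma semigroup_sum_eq_sum:
  fixes f :: "nat \<Rightarrow> 'a::comm_monoid_add"
  assumes "finite I" "I \<noteq> {}"
  shows "semigroup_sum f I = sum f I"
  using assms by (induction rule: finite_ne_induct) (simp_all add: semigroup_sum_insert)

text \<open>
  An \<open>r \<times> n\<close> matrix over \<open>'a\<close> is given by a map \<open>M\<close> of which only the entries \<open>M i j\<close> with
  \<open>i \<in> {1..r}\<close> and \<open>j \<in> {1..n}\<close> matter.
\<close>

definition combinatorially_rich :: "'a::ab_semigroup_add set \<Rightarrow> bool" where
  "combinatorially_rich A \<longleftrightarrow>
     (\<forall>n::nat. \<exists>r::nat. \<forall>M :: nat \<Rightarrow> nat \<Rightarrow> 'a. \<exists>\<alpha> s.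
        \<alpha> \<noteq> {} \<and> \<alpha> \<subseteq> {1..r} \<and>
        (\<forall>j\<in>{1..n}. s + semigroup_sum (\<lambda>i. M i j) \<alpha> \<in> A))"

end

theory Submission
  imports Defs
begin

text \<open>
  The matrix entries enter only through the points \<open>x + M 1 (w 1) + \<dots> + M r (w r)\<close> for words \<open>w\<close> of length
  \<open>r\<close> over \<open>n\<close> letters. An invariant mean with \<open>\<lambda>(1\<^sub>A) > 0\<close> yields an \<open>x\<close> for which a dense set of words
  has its point in \<open>A\<close>, and a combinatorial line in that set is the required configuration: \<open>\<alpha>\<close> is the
  set of its wildcards. So the theorem reduces to the density Hales--Jewett theorem, which is proved
  by induction on the alphabet with a density increment in the style of Polymath and
  Dodos--Kanellopoulos--Tyros. If \<open>A\<close> contains no line over the letters \<open>0, \<dots>, k\<close>, then on a suitable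
  subspace \<open>A\<close> almost avoids the set \<open>D\<close> of words that land in \<open>A\<close> whenever all letters \<open>k\<close> are changed
  into one \<open>a < k\<close>; by the theorem for \<open>k\<close> letters \<open>D\<close> has density bounded below. Hence \<open>A\<close> is
  denser than average on the complement of \<open>D\<close>, which splits into \<open>k\<close> intersections of insensitive
  sets. Those are almost unions of subspaces, again by the theorem for \<open>k\<close> letters, and on one of these
  the density of \<open>A\<close> has increased.
\<close>

section \<open>Means on finite sets\<close>

text \<open>A random object is represented by its expectation functional alone, so that
  distributions can be composed without handling weights. Positivity is tested on \<open>T\<close>
  only, which makes \<open>T\<close> a support.\<close>

definition mean_on :: "'i set \<Rightarrow> (('i \<Rightarrow> real) \<Rightarrow> real) \<Rightarrow> bool" where
  "mean_on T E \<longleftrightarrow>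
     (\<forall>f g. E (\<lambda>i. f i + g i) = E f + E g) \<and> (\<forall>c f. E (\<lambda>i. c * f i) = c * E f) \<and>
     (\<forall>f. (\<forall>i\<in>T. 0 \<le> f i) \<longrightarrow> 0 \<le> E f) \<and> E (\<lambda>_. 1) = 1"

context
  fixes T :: "'i set" and E :: "('i \<Rightarrow> real) \<Rightarrow> real"
  assumes E: "mean_on T E"
begin

lemma mean_add: "E (\<lambda>i. f i + g i) = E f + E g"
  using E[unfolded mean_on_def, THEN conjunct1, THEN spec, THEN spec, of f g] .

lemma mean_cmult: "E (\<lambda>i. c * f i) = c * E f"
  using E[unfolded mean_on_def, THEN conjunct2, THEN conjunct1, THEN spec, THEN spec, of c f] .

lemma mean_nonneg: "(\<And>i. i \<in> T \<Longrightarrow> 0 \<le> f i) \<Longrightarrow> 0 \<le> E f"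
  using E[unfolded mean_on_def, THEN conjunct2, THEN conjunct2, THEN conjunct1, THEN spec, of f] by simp

lemma mean_one: "E (\<lambda>_. 1) = 1"
  using E by (simp add: mean_on_def)

lemma mean_const: "E (\<lambda>_. c) = c"
  using mean_cmult[of c "\<lambda>_. 1"] mean_one by simp

lemma mean_diff: "E (\<lambda>i. f i - g i) = E f - E g"
  using mean_add[of f "\<lambda>i. - 1 * g i"] mean_cmult[of "- 1" g] by simp

lemma mean_mono: "(\<And>i. i \<in> T \<Longrightarrow> f i \<le> g i) \<Longrightarrow> E f \<le> E g"
  using mean_nonneg[of "\<lambda>i. g i - f i"] mean_diff[of g f] by simp

lemma mean_cong: "(\<And>i. i \<in> T \<Longrightarrow> f i = g i) \<Longrightarrow> E f = E g"
  by (intro antisym mean_mono) auto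

lemma mean_sum: "E (\<lambda>i. \<Sum>x\<in>X. f x i) = (\<Sum>x\<in>X. E (f x))"
proof (induction X rule: infinite_finite_induct)
  case (insert x F)
  then show ?case using mean_add[of "f x" "\<lambda>i. \<Sum>x\<in>F. f x i"] by simp
qed (simp_all add: mean_const)

lemma mean_le_const: "(\<And>i. i \<in> T \<Longrightarrow> f i \<le> c) \<Longrightarrow> E f \<le> c"
  using mean_mono[of f "\<lambda>_. c"] mean_const[of c] by simp

lemma mean_ge_const: "(\<And>i. i \<in> T \<Longrightarrow> c \<le> f i) \<Longrightarrow> c \<le> E f"
  using mean_mono[of "\<lambda>_. c" f] mean_const[of c] by simp

lemma mean_nonempty: "T \<noteq> {}"
  using mean_nonneg[of "\<lambda>_. -1"] mean_const[of "-1"] by auto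

lemma mean_exists_ge:
  assumes "c \<le> E f" "finite T"
  shows "\<exists>i\<in>T. c \<le> f i"
proof (rule ccontr)
  assume *: "\<not> ?thesis"
  have "E f \<le> Max (f ` T)" using assms by (intro mean_le_const) auto
  moreover have "Max (f ` T) < c" using * assms mean_nonempty by (subst Max_less_iff) auto
  ultimately show False using assms by linarith
qed

text \<open>Otherwise \<open>g y \<le> d / 2 + (\<Sum>p\<in>P. of_bool (R p y))\<close> on
  \<open>T\<close> would integrate to less than \<open>d\<close>. This trades "for many
  \<open>y\<close> some \<open>p\<close>" for "one \<open>p\<close> for many
  \<open>y\<close>".\<close>

lemma mean_pigeonhole:
  assumes "finite P" "d \<le> E g" "\<And>y. y \<in> T \<Longrightarrow> g y \<le> 1" "0 < d"
    and ex: "\<And>y. y \<in> T \<Longrightarrow> d / 2 \<le> g y \<Longrightarrow> \<exists>p\<in>P. R p y"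
  shows "\<exists>p\<in>P. d / 2 / card P \<le> E (\<lambda>y. of_bool (R p y))"
proof (rule ccontr)
  assume *: "\<not> ?thesis"
  have "E g \<le> E (\<lambda>y. d / 2 + (\<Sum>p\<in>P. of_bool (R p y)))"
  proof (rule mean_mono)
    fix y assume y: "y \<in> T"
    show "g y \<le> d / 2 + (\<Sum>p\<in>P. of_bool (R p y))"
    proof (cases "d / 2 \<le> g y")
      case True
      then obtain p where p: "p \<in> P" "R p y" using ex y by blast
      then have "(1::real) \<le> (\<Sum>p\<in>P. of_bool (R p y))"
        using member_le_sum[of p P "\<lambda>p. of_bool (R p y) :: real"] \<open>finite P\<close> by simp
      then show ?thesis using assms(3)[OF y] assms(4) by linarith
    next
      case False
      have "(0::real) \<le> (\<Sum>p\<in>P. of_bool (R p y))" by (rule sum_nonneg) simp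
      then show ?thesis using False by linarith
    qed
  qed
  also have "\<dots> = d / 2 + (\<Sum>p\<in>P. E (\<lambda>y. of_bool (R p y)))"
    by (simp add: mean_add mean_const mean_sum)
  finally have le: "d / 2 \<le> (\<Sum>p\<in>P. E (\<lambda>y. of_bool (R p y)))" using assms(2) by linarith
  then have "P \<noteq> {}" using assms(4) by auto
  then have "(\<Sum>p\<in>P. E (\<lambda>y. of_bool (R p y))) < (\<Sum>p\<in>P. d / 2 / card P)"
    using * \<open>finite P\<close> by (intro sum_strict_mono) auto
  also have "\<dots> = d / 2" using \<open>P \<noteq> {}\<close> \<open>finite P\<close> by simp
  finally show False using le by simp
qed

end

section \<open>Words and combinatorial subspaces\<close>

definition words :: "nat \<Rightarrow> nat \<Rightarrow> nat list set" where
  "words k n = {w. length w = n \<and> set w \<subseteq> {..<k}}"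

definition avg :: "nat \<Rightarrow> nat \<Rightarrow> (nat list \<Rightarrow> real) \<Rightarrow> real" where
  "avg k n f = (\<Sum>w\<in>words k n. f w) / k ^ n"

text \<open>
  An \<open>m\<close>-dimensional subspace of \<open>words k n\<close> is parametrised by a word whose letters are either
  constants \<open>Inl a\<close> or wildcards \<open>Inr j\<close>, each of the \<open>m\<close> wildcards occurring at least once.
\<close>

definition templates :: "nat \<Rightarrow> nat \<Rightarrow> nat \<Rightarrow> (nat + nat) list set" where
  "templates k m n =
     {p. length p = n \<and> set p \<subseteq> Inl ` {..<k} \<union> Inr ` {..<m} \<and> Inr ` {..<m} \<subseteq> set p}"

definition fill :: "(nat + nat) list \<Rightarrow> nat list \<Rightarrow> nat list" where
  "fill p z = map (case_sum (\<lambda>a. a) (\<lambda>j. z ! j)) p"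

definition subst_template :: "(nat + nat) list \<Rightarrow> (nat + nat) list \<Rightarrow> (nat + nat) list" where
  "subst_template p q = map (case_sum Inl (\<lambda>j. q ! j)) p"

definition join :: "(nat + nat) list \<Rightarrow> (nat + nat) list \<Rightarrow> (nat + nat) list" where
  "join p q = p @ map (map_sum id Suc) q"

lemma words_0 [simp]: "words k 0 = {[]}"
  by (auto simp: words_def)

lemma words_length: "w \<in> words k n \<Longrightarrow> length w = n"
  by (simp add: words_def)

lemma words_nth: "w \<in> words k n \<Longrightarrow> i < n \<Longrightarrow> w ! i < k"
  unfolding words_def using nth_mem by blast

lemma words_mono: "w \<in> words k n \<Longrightarrow> k \<le> k' \<Longrightarrow> w \<in> words k' n"
  by (auto simp: words_def)

lemma words_Suc_eq: "words k (Suc n) = (\<lambda>(a, w). a # w) ` ({..<k} \<times> words k n)"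
  by (auto simp: words_def length_Suc_conv image_iff)

lemma Cons_in_words [simp]: "a # w \<in> words k (Suc n) \<longleftrightarrow> a < k \<and> w \<in> words k n"
  by (auto simp: words_def)

lemma words_1: "words k 1 = (\<lambda>a. [a]) ` {..<k}"
  by (auto simp: words_Suc_eq)

lemma finite_words [simp]: "finite (words k n)"
  using finite_lists_length_eq[of "{..<k}" n] by (simp add: words_def conj_commute)

lemma card_words: "card (words k n) = k ^ n"
  using card_lists_length_eq[of "{..<k}" n] by (simp add: words_def conj_commute)

lemma words_append: "words k (a + b) = (\<lambda>(x, y). x @ y) ` (words k a \<times> words k b)"
proof
  show "words k (a + b) \<subseteq> (\<lambda>(x, y). x @ y) ` (words k a \<times> words k b)"
  proof
    fix w assume w: "w \<in> words k (a + b)"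
    have "take a w \<in> words k a" "drop a w \<in> words k b"
      using w by (auto simp: words_def dest: in_set_takeD in_set_dropD)
    then show "w \<in> (\<lambda>(x, y). x @ y) ` (words k a \<times> words k b)"
      by (intro image_eqI[of _ _ "(take a w, drop a w)"]) auto
  qed
qed (auto simp: words_def)

lemma append_in_words: "x \<in> words k a \<Longrightarrow> y \<in> words k b \<Longrightarrow> x @ y \<in> words k (a + b)"
  by (auto simp: words_def)

section \<open>Uniform averages over words\<close>

lemma mean_avg: "0 < k \<Longrightarrow> mean_on (words k n) (avg k n)"
  by (auto simp: mean_on_def avg_def sum.distrib add_divide_distrib sum_distrib_left sum_nonneg card_words)

lemma avg_cong: "(\<And>w. w \<in> words k n \<Longrightarrow> f w = g w) \<Longrightarrow> avg k n f = avg k n g"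
  by (simp add: avg_def)

lemma avg_append: "avg k (a + b) f = avg k a (\<lambda>x. avg k b (\<lambda>y. f (x @ y)))"
proof -
  have "inj_on (\<lambda>(x, y). x @ y) (words k a \<times> words k b)"
    by (auto simp: inj_on_def words_def)
  then have "(\<Sum>w\<in>words k (a + b). f w) = (\<Sum>x\<in>words k a. \<Sum>y\<in>words k b. f (x @ y))"
    by (simp add: words_append sum.reindex sum.cartesian_product case_prod_unfold)
  then show ?thesis by (simp add: avg_def power_add sum_divide_distrib mult.commute)
qed

lemma avg_0 [simp]: "avg k 0 f = f []"
  by (simp add: avg_def)

lemma avg_1: "avg k 1 f = (\<Sum>a<k. f [a]) / k"
  unfolding avg_def words_1 by (subst sum.reindex) (auto simp: inj_on_def)

lemma avg_Suc: "avg k (Suc n) f = (\<Sum>a<k. avg k n (\<lambda>w. f (a # w))) / k"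
  using avg_append[of k 1 n f] by (simp only: avg_1 append.simps plus_1_eq_Suc)

lemma mean_avg_swap:
  assumes "mean_on T E"
  shows "E (\<lambda>i. avg k n (f i)) = avg k n (\<lambda>w. E (\<lambda>i. f i w))"
proof -
  have "E (\<lambda>i. (1 / k ^ n) * (\<Sum>w\<in>words k n. f i w)) = (1 / k ^ n) * (\<Sum>w\<in>words k n. E (\<lambda>i. f i w))"
    by (simp only: mean_cmult[OF assms] mean_sum[OF assms])
  then show ?thesis by (simp add: avg_def)
qed

section \<open>Templates, their fillings and their compositions\<close>

lemma finite_templates [simp]: "finite (templates k m n)"
proof (rule finite_subset)
  show "templates k m n \<subseteq> {p. set p \<subseteq> Inl ` {..<k} \<union> Inr ` {..<m} \<and> length p = n}"
    by (auto simp: templates_def)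
qed (rule finite_lists_length_eq, simp)

lemma templates_0_0 [simp]: "templates k 0 0 = {[]}"
  by (auto simp: templates_def)

lemma templates_mono: "p \<in> templates k m n \<Longrightarrow> k \<le> k' \<Longrightarrow> p \<in> templates k' m n"
  unfolding templates_def by (auto dest!: subsetD)

lemma fill_append: "fill (p @ q) z = fill p z @ fill q z"
  by (simp add: fill_def)

lemma fill_const [simp]: "fill (map Inl x) z = x"
  by (simp add: fill_def comp_def)

lemma fill_in_words:
  assumes "p \<in> templates k m n" "z \<in> words k m"
  shows "fill p z \<in> words k n"
proof -
  have "case_sum (\<lambda>a. a) (\<lambda>j. z ! j) e < k" if "e \<in> set p" for e
  proof -
    have "z ! j < k" if "j < m" for j using words_nth[OF assms(2) that] .
    moreover have "e \<in> Inl ` {..<k} \<union> Inr ` {..<m}" using assms(1) that by (auto simp: templates_def)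
    ultimately show ?thesis by auto
  qed
  then show ?thesis using assms(1) by (auto simp: templates_def words_def fill_def)
qed

lemma fill_inj: "p \<in> templates k m n \<Longrightarrow> inj_on (fill p) (words k' m)"
proof (rule inj_onI)
  fix y z assume p: "p \<in> templates k m n" and yz: "y \<in> words k' m" "z \<in> words k' m" "fill p y = fill p z"
  show "y = z"
  proof (rule nth_equalityI)
    fix j assume "j < length y"
    then have "Inr j \<in> set p" using yz p by (auto simp: words_def templates_def)
    then show "y ! j = z ! j" using yz(3) by (auto simp: fill_def)
  qed (use yz in \<open>simp add: words_def\<close>)
qed

lemma fill_subst_template:
  assumes "p \<in> templates k m n" "length q = m"
  shows "fill (subst_template p q) z = fill p (fill q z)"
proof -
  have "\<And>e. e \<in> set p \<Longrightarrow> case_sum (\<lambda>a. a) (\<lambda>j. z ! j) (case_sum Inl (\<lambda>j. q ! j) e) =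
      case_sum (\<lambda>a. a) (\<lambda>j. fill q z ! j) e"
    using assms by (auto simp: templates_def fill_def)
  then show ?thesis by (simp add: fill_def[of p] fill_def[of "map _ p"] subst_template_def comp_def)
qed

lemma subst_template_in_templates:
  assumes p: "p \<in> templates k m n" and q: "q \<in> templates k l m"
  shows "subst_template p q \<in> templates k l n"
proof -
  have "set (subst_template p q) \<subseteq> Inl ` {..<k} \<union> Inr ` {..<l}"
  proof
    fix e assume "e \<in> set (subst_template p q)"
    then obtain d where d: "d \<in> set p" "e = case_sum Inl (\<lambda>j. q ! j) d"
      by (auto simp: subst_template_def)
    show "e \<in> Inl ` {..<k} \<union> Inr ` {..<l}"
    proof (cases d)
      case (Inl a) then show ?thesis using d p by (auto simp: templates_def)
    next
      case (Inr j)
      then have "j < m" using d p by (auto simp: templates_def)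
      then have "q ! j \<in> set q" using q by (auto simp: templates_def)
      then show ?thesis using d q Inr by (auto simp: templates_def)
    qed
  qed
  moreover have "Inr ` {..<l} \<subseteq> set (subst_template p q)"
  proof
    fix e :: "nat + nat" assume "e \<in> Inr ` {..<l}"
    then have "e \<in> set q" using q by (auto simp: templates_def)
    then obtain j where j: "j < m" "e = q ! j" using q by (auto simp: templates_def in_set_conv_nth)
    then have "Inr j \<in> set p" using p by (auto simp: templates_def)
    then show "e \<in> set (subst_template p q)" using j by (force simp: subst_template_def)
  qed
  ultimately show ?thesis using p by (simp add: templates_def subst_template_def)
qed

lemma id_in_templates: "map Inr [0..<m] \<in> templates k m m"
  by (auto simp: templates_def)

lemma fill_id: "length z = m \<Longrightarrow> fill (map Inr [0..<m]) z = z"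
  using map_nth[of z] by (simp add: fill_def comp_def)

lemma prefix_in_templates:
  "x \<in> words k a \<Longrightarrow> p \<in> templates k m n \<Longrightarrow> map Inl x @ p \<in> templates k m (a + n)"
  by (auto simp: words_def templates_def)

lemma suffix_in_templates:
  "x \<in> words k a \<Longrightarrow> p \<in> templates k m n \<Longrightarrow> p @ map Inl x \<in> templates k m (n + a)"
  by (auto simp: words_def templates_def)

lemma join_in_templates:
  assumes "p \<in> templates k 1 a" "q \<in> templates k m b"
  shows "join p q \<in> templates k (Suc m) (a + b)"
proof -
  have "set (map (map_sum id Suc) q) \<subseteq> Inl ` {..<k} \<union> Inr ` {..<Suc m}"
  proof
    fix e assume "e \<in> set (map (map_sum id Suc) q)"
    then obtain d where d: "d \<in> set q" "e = map_sum id Suc d" by auto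
    then show "e \<in> Inl ` {..<k} \<union> Inr ` {..<Suc m}"
      using assms(2) by (cases d) (auto simp: templates_def)
  qed
  moreover have "Inr ` {..<Suc m} \<subseteq> set p \<union> set (map (map_sum id Suc) q)"
  proof
    fix e :: "nat + nat" assume "e \<in> Inr ` {..<Suc m}"
    then obtain j where j: "e = Inr j" "j < Suc m" by auto
    show "e \<in> set p \<union> set (map (map_sum id Suc) q)"
    proof (cases j)
      case 0 then show ?thesis using assms(1) j by (auto simp: templates_def)
    next
      case (Suc i)
      then have "Inr i \<in> set q" using assms(2) j by (auto simp: templates_def)
      then have "map_sum id Suc (Inr i) \<in> set (map (map_sum id Suc) q)" by (metis imageI set_map)
      then show ?thesis using j Suc by simp
    qed
  qed
  moreover have "set p \<subseteq> Inl ` {..<k} \<union> Inr ` {..<Suc m}"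
    using assms(1) by (auto simp: templates_def)
  ultimately show ?thesis using assms by (simp add: templates_def join_def)
qed

lemma fill_join:
  assumes "p \<in> templates k 1 a"
  shows "fill (join p q) (c # z) = fill p [c] @ fill q z"
proof -
  have "case_sum (\<lambda>a. a) (\<lambda>j. (c # z) ! j) e = case_sum (\<lambda>a. a) (\<lambda>j. [c] ! j) e" if "e \<in> set p" for e
    using that assms by (auto simp: templates_def)
  moreover have "case_sum (\<lambda>a. a) (\<lambda>j. (c # z) ! j) (map_sum id Suc e) = case_sum (\<lambda>a. a) (\<lambda>j. z ! j) e" for e
    by (cases e) auto
  ultimately show ?thesis by (auto simp: fill_def join_def comp_def)
qed

section \<open>The density Hales--Jewett property\<close>

text \<open>Density Hales--Jewett for \<open>m\<close>-dimensional subspaces at the single length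
  \<open>n\<close>. For \<open>d > 1\<close> it holds vacuously, which starts the descent in
  \<open>density_Hales_Jewett\<close>.\<close>

definition hj :: "nat \<Rightarrow> nat \<Rightarrow> real \<Rightarrow> nat \<Rightarrow> bool" where
  "hj k m d n \<longleftrightarrow> (\<forall>A. d \<le> avg k n (\<lambda>w. of_bool (w \<in> A)) \<longrightarrow>
     (\<exists>p\<in>templates k m n. \<forall>z\<in>words k m. fill p z \<in> A))"

text \<open>Words are split as \<open>x @ y\<close>. For many \<open>y\<close> the section of
  \<open>A\<close> contains a line, and by pigeonhole the same line for a set of \<open>y\<close> of
  density \<open>th\<close>; an \<open>m\<close>-dimensional subspace of that set is joined to the
  line.\<close>

lemma hj_multi:
  assumes k: "0 < k" and line: "\<And>d. 0 < d \<Longrightarrow> \<exists>n. hj k 1 d n" and "0 < d"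
  shows "\<exists>n. hj k m d n"
  using \<open>0 < d\<close>
proof (induction m arbitrary: d)
  case 0
  have "hj k 0 d 0" unfolding hj_def using 0 by (auto simp: fill_def)
  then show ?case by blast
next
  case (Suc m)
  obtain a where a: "hj k 1 (d / 2) a" using line Suc.prems by (meson half_gt_zero)
  define th where "th = d / 2 / card (templates k 1 a)"
  show ?case
  proof (cases "templates k 1 a = {}")
    case True
    \<comment> \<open>Without line templates, \<open>hj k 1 (d / 2) a\<close> says that no set
      reaches density \<open>d / 2\<close>, so the claim holds vacuously at length
      \<open>a\<close>.\<close>
    have "\<not> d \<le> avg k a (\<lambda>w. of_bool (w \<in> A))" for A
    proof
      assume "d \<le> avg k a (\<lambda>w. of_bool (w \<in> A))"
      then have "d / 2 \<le> avg k a (\<lambda>w. of_bool (w \<in> A))" using Suc.prems by linarith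
      then show False using a True unfolding hj_def by blast
    qed
    then show ?thesis unfolding hj_def by blast
  next
    case False
    then have "0 < th" unfolding th_def using Suc.prems by (simp add: card_gt_0_iff)
    then obtain n where n: "hj k m th n" using Suc.IH by blast
    have "hj k (Suc m) d (a + n)" unfolding hj_def
    proof (intro allI impI)
      fix A assume dA: "d \<le> avg k (a + n) (\<lambda>w. of_bool (w \<in> A))"
      define g where "g y = avg k a (\<lambda>x. of_bool (x @ y \<in> A))" for y
      have "\<exists>p\<in>templates k 1 a. d / 2 / card (templates k 1 a)
          \<le> avg k n (\<lambda>y. of_bool (\<forall>z\<in>words k 1. fill p z @ y \<in> A))"
      proof (rule mean_pigeonhole[OF mean_avg[OF k]])
        show "d \<le> avg k n g" using dA unfolding g_def avg_append
          by (subst mean_avg_swap[OF mean_avg[OF k]])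
        show "\<And>y. g y \<le> 1" unfolding g_def by (rule mean_le_const[OF mean_avg[OF k]]) simp
        show "\<exists>p\<in>templates k 1 a. \<forall>z\<in>words k 1. fill p z @ y \<in> A" if "d / 2 \<le> g y" for y
          using a[unfolded hj_def, rule_format, of "{x. x @ y \<in> A}"] that unfolding g_def by simp
      qed (use Suc.prems in auto)
      then obtain p where p: "p \<in> templates k 1 a"
        "th \<le> avg k n (\<lambda>y. of_bool (y \<in> {y. \<forall>z\<in>words k 1. fill p z @ y \<in> A}))"
        unfolding th_def by auto
      then obtain q where q: "q \<in> templates k m n" "\<forall>z\<in>words k m. fill q z \<in> {y. \<forall>z\<in>words k 1. fill p z @ y \<in> A}"
        using n unfolding hj_def by blast
      have "\<forall>z\<in>words k (Suc m). fill (join p q) z \<in> A"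
        using q by (auto simp: words_Suc_eq fill_join[OF p(1)] words_1 simp del: One_nat_def)
      then show "\<exists>p\<in>templates k (Suc m) (a + n). \<forall>z\<in>words k (Suc m). fill p z \<in> A"
        using join_in_templates[OF p(1) q(1)] by blast
    qed
    then show ?thesis by blast
  qed
qed


section \<open>Random subspaces all of whose points are almost uniformly distributed\<close>

text \<open>Induction by splitting off the first letter: its centred indicators \<open>Y b\<close>
  sum to zero, which kills the cross term, and their squares are at most 1.\<close>

lemma letter_count_variance:
  assumes "a < k"
  shows "avg k n (\<lambda>w. (real (count_list w a) - n / k)\<^sup>2) \<le> n"
proof (induction n)
  case 0
  then show ?case by simp
next
  case (Suc n)
  have k: "0 < k" using assms by simp
  note M = mean_avg[OF k, of n]
  define X where "X w = real (count_list w a) - n / k" for w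
  define Y where "Y b = of_bool (b = a) - 1 / real k" for b
  have eq: "(real (count_list (b # w) a) - real (Suc n) / real k)\<^sup>2 = (X w)\<^sup>2 + (2 * Y b * X w + (Y b)\<^sup>2)" for b w
  proof -
    have "real (count_list (b # w) a) - real (Suc n) / real k = X w + Y b"
      by (simp add: X_def Y_def add_divide_distrib)
    then show ?thesis by (simp add: power2_eq_square algebra_simps)
  qed
  have avg_eq: "avg k n (\<lambda>w. (X w)\<^sup>2 + (2 * Y b * X w + (Y b)\<^sup>2))
      = avg k n (\<lambda>w. (X w)\<^sup>2) + (2 * Y b * avg k n X + (Y b)\<^sup>2)" for b
    using mean_cmult[OF M, of "2 * Y b" X] by (simp add: mean_add[OF M] mean_const[OF M])
  have sumY: "(\<Sum>b<k. Y b) = 0"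
    using assms k by (simp add: Y_def sum_subtractf of_bool_def)
  have Y1: "(Y b)\<^sup>2 \<le> 1" for b
  proof -
    have "\<bar>Y b\<bar> \<le> 1" using k by (auto simp: Y_def of_bool_def)
    then show ?thesis by (simp add: abs_square_le_1)
  qed
  have "(\<Sum>b<k. avg k n (\<lambda>w. (X w)\<^sup>2) + (2 * Y b * avg k n X + (Y b)\<^sup>2))
      = k * avg k n (\<lambda>w. (X w)\<^sup>2) + 2 * (\<Sum>b<k. Y b) * avg k n X + (\<Sum>b<k. (Y b)\<^sup>2)"
    by (simp add: sum.distrib sum_distrib_left sum_distrib_right)
  also have "\<dots> \<le> real k * real n + real k"
    unfolding sumY using mult_left_mono[OF Suc, of "real k"]
      sum_mono[of "{..<k}" "\<lambda>b. (Y b)\<^sup>2" "\<lambda>_. 1"] Y1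
    by (simp add: X_def)
  also have "\<dots> = real (Suc n) * real k" by (simp add: algebra_simps)
  finally show ?case
    unfolding avg_Suc eq avg_eq using k by (simp only: pos_divide_le_eq of_nat_0_less_iff)
qed

text \<open>Overwriting a letter of a uniform word by \<open>a\<close> amounts to conditioning on
  the event \<open>y ! i = a\<close>, whose probability is \<open>1 / k\<close>.\<close>

lemma avg_update_letter:
  assumes "i < n" "a < k"
  shows "avg k n (\<lambda>y. g (y[i := a])) = k * avg k n (\<lambda>y. g y * of_bool (y ! i = a))"
proof -
  obtain r where n: "n = i + Suc r" using assms(1) less_iff_Suc_add by auto
  have k: "0 < k" using assms by simp
  have 1: "avg k (Suc r) (\<lambda>y. g ((u @ y)[i := a])) = avg k r (\<lambda>v. g (u @ a # v))"
    if "u \<in> words k i" for u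
    using words_length[OF that] k by (simp add: avg_Suc list_update_append)
  have 2: "k * avg k (Suc r) (\<lambda>y. g (u @ y) * of_bool ((u @ y) ! i = a)) = avg k r (\<lambda>v. g (u @ a # v))"
    if "u \<in> words k i" for u
  proof -
    have "avg k r (\<lambda>v. g (u @ b # v) * of_bool (b = a)) = (if b = a then avg k r (\<lambda>v. g (u @ a # v)) else 0)" for b
      by (simp add: mean_const[OF mean_avg[OF k]])
    moreover have "(u @ b # v) ! i = b" for b v using words_length[OF that] by (metis nth_append_length)
    ultimately show ?thesis using k assms(2) by (simp add: avg_Suc)
  qed
  show ?thesis
    unfolding n avg_append mean_cmult[OF mean_avg[OF k, of i], symmetric]
    by (rule avg_cong) (simp only: 1 2)
qed

lemma sum_of_bool_nth: "length y = n \<Longrightarrow> (\<Sum>i<n. of_bool (y ! i = a)) = real (count_list y a)"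
proof -
  assume "length y = n"
  then have "count_list y a = card {i. i < n \<and> a = y ! i}"
    by (simp add: count_list_eq_length_filter length_filter_conv_card)
  also have "{i. i < n \<and> a = y ! i} = {i \<in> {..<n}. y ! i = a}" by auto
  finally show ?thesis by (simp add: sum.If_cases of_bool_def Int_def)
qed

text \<open>
  The random line is a uniform random word with one wildcard at a uniform random position; planting a
  letter there is harmless because letter counts concentrate.
\<close>

lemma uniform_line:
  assumes "0 < k" "0 < eps"
  shows "\<exists>n E. mean_on (templates k 1 n) E \<and> (\<forall>a<k. \<forall>g. (\<forall>w\<in>words k n. 0 \<le> g w \<and> g w \<le> 1) \<longrightarrow>
    avg k n g - eps \<le> E (\<lambda>p. g (fill p [a])))"
proof -
  \<comment> \<open>This makes the variance bound \<open>n\<close> of a letter count at most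
    \<open>c\<^sup>2\<close> for the tolerance \<open>c = n * eps / k\<close> used below.\<close>
  obtain n :: nat where n: "(k / eps)\<^sup>2 < n" using reals_Archimedean2 by blast
  have n0: "0 < n" using n by (metis of_nat_0_less_iff order_le_less_trans zero_le_power2)
  define E where "E h = (\<Sum>i<n. avg k n (\<lambda>y. h ((map Inl y)[i := Inr 0]))) / n"
    for h :: "(nat + nat) list \<Rightarrow> real"
  note M = mean_avg[OF assms(1), of n]
  have tmpl: "(map Inl y)[i := Inr 0] \<in> templates k 1 n" if "y \<in> words k n" "i < n" for y i
  proof -
    have "set ((map Inl y)[i := Inr 0]) \<subseteq> insert (Inr 0) (Inl ` {..<k} :: (nat + nat) set)"
      using that(1) by (intro order_trans[OF set_update_subset_insert]) (auto simp: words_def)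
    moreover have "Inr 0 \<in> set ((map Inl y)[i := Inr 0])"
      using that by (intro set_update_memI) (simp add: words_def)
    ultimately show ?thesis using that(1) by (auto simp: templates_def words_length)
  qed
  have E: "mean_on (templates k 1 n) E"
    unfolding mean_on_def
  proof (intro conjI allI impI)
    fix f :: "(nat + nat) list \<Rightarrow> real" assume *: "\<forall>p\<in>templates k 1 n. 0 \<le> f p"
    have "0 \<le> avg k n (\<lambda>y. f ((map Inl y)[i := Inr 0]))" if "i < n" for i
      using * tmpl[OF _ that] by (intro mean_nonneg[OF M]) blast
    then show "0 \<le> E f" unfolding E_def by (intro divide_nonneg_nonneg sum_nonneg) auto
  qed (use n0 in \<open>auto simp: E_def mean_add[OF M] mean_cmult[OF M] mean_const[OF M] sum.distrib
      add_divide_distrib sum_distrib_left\<close>)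
  have "avg k n g - eps \<le> E (\<lambda>p. g (fill p [a]))"
    if a: "a < k" and g: "\<And>w. w \<in> words k n \<Longrightarrow> 0 \<le> g w \<and> g w \<le> 1" for a g
  proof -
    define X where "X y = real (count_list y a) - n / k" for y
    have fill: "fill ((map Inl y)[i := Inr 0]) [a] = y[i := a]" for y i
      by (simp add: fill_def map_update comp_def)
    have "E (\<lambda>p. g (fill p [a])) = (\<Sum>i<n. avg k n (\<lambda>y. k * (g y * of_bool (y ! i = a)))) / n"
      unfolding E_def fill using a by (simp add: avg_update_letter mean_cmult[OF M])
    also have "\<dots> = avg k n (\<lambda>y. \<Sum>i<n. k * (g y * of_bool (y ! i = a))) / n"
      by (simp add: mean_sum[OF M])
    also have "\<dots> = avg k n (\<lambda>y. 1 / n * (\<Sum>i<n. k * (g y * of_bool (y ! i = a))))"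
      by (simp only: mean_cmult[OF M]) simp
    \<comment> \<open>As the wildcard position is uniform, the word \<open>y\<close> receives the
      weight \<open>k / n\<close> times its number of letters \<open>a\<close>, which is
      \<open>1 + k / n * X y\<close>.\<close>
    also have "\<dots> = avg k n (\<lambda>y. g y + k / n * (g y * X y))"
    proof (rule avg_cong)
      fix y assume y: "y \<in> words k n"
      have "(\<Sum>i<n. k * (g y * of_bool (y ! i = a))) = k * g y * count_list y a"
        unfolding sum_of_bool_nth[OF words_length[OF y], symmetric] sum_distrib_left
        by (simp only: mult.assoc)
      then show "1 / n * (\<Sum>i<n. k * (g y * of_bool (y ! i = a))) = g y + k / n * (g y * X y)"
        using n0 assms(1) by (simp add: X_def field_simps)
    qed
    finally have E: "E (\<lambda>p. g (fill p [a])) = avg k n g + k / n * avg k n (\<lambda>y. g y * X y)"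
      by (simp only: mean_add[OF M] mean_cmult[OF M])
    define c where "c = n * eps / k"
    have c: "0 < c" unfolding c_def using n0 assms by simp
    \<comment> \<open>This follows from \<open>(c - \<bar>X y\<bar>)\<^sup>2 \<ge> 0\<close> and
      lets the variance bound control a first moment without square roots.\<close>
    have "- (g y * X y) \<le> c / 2 + 1 / (2 * c) * (X y)\<^sup>2" if "y \<in> words k n" for y
    proof -
      have "\<bar>g y * X y\<bar> \<le> 1 * \<bar>X y\<bar>" unfolding abs_mult using g[OF that] by (intro mult_right_mono) auto
      moreover have "c / 2 + 1 / (2 * c) * (X y)\<^sup>2 - \<bar>X y\<bar> = (c - \<bar>X y\<bar>)\<^sup>2 / (2 * c)"
        using c by (simp add: power2_eq_square field_simps)
      moreover have "0 \<le> (c - \<bar>X y\<bar>)\<^sup>2 / (2 * c)" using c by simp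
      ultimately show ?thesis by linarith
    qed
    then have "avg k n (\<lambda>y. - (g y * X y)) \<le> avg k n (\<lambda>y. c / 2 + 1 / (2 * c) * (X y)\<^sup>2)"
      by (rule mean_mono[OF M])
    also have "\<dots> = c / 2 + 1 / (2 * c) * avg k n (\<lambda>y. (X y)\<^sup>2)"
      by (simp only: mean_add[OF M] mean_cmult[OF M] mean_const[OF M])
    also have "\<dots> \<le> c / 2 + 1 / (2 * c) * n"
      using letter_count_variance[OF a, of n] c unfolding X_def by (intro add_left_mono mult_left_mono) auto
    also have "\<dots> \<le> c"
    proof -
      have "n \<le> c\<^sup>2"
      proof -
        have "(real k)\<^sup>2 < n * eps\<^sup>2"
          using n assms by (simp add: power_divide pos_divide_less_eq)
        then have "n * (real k)\<^sup>2 \<le> n * (n * eps\<^sup>2)" by (intro mult_left_mono) auto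
        then show ?thesis using assms
          by (simp add: c_def power_divide power_mult_distrib pos_le_divide_eq)
            (simp add: power2_eq_square mult_ac)
      qed
      then show ?thesis using c by (simp add: power2_eq_square field_simps)
    qed
    finally have "- c \<le> avg k n (\<lambda>y. g y * X y)"
      using mean_cmult[OF M, of "-1" "\<lambda>y. g y * X y"] by simp
    then have "k / n * (- c) \<le> k / n * avg k n (\<lambda>y. g y * X y)"
      by (intro mult_left_mono) auto
    moreover have "k / n * (- c) = - eps" unfolding c_def using n0 assms by simp
    ultimately show ?thesis unfolding E by linarith
  qed
  then show ?thesis
    by (intro exI[of _ n] exI[of _ E] conjI[OF E] allI impI) blast
qed

text \<open>A random line and an independent random \<open>m\<close>-dimensional subspace are
  joined, each costing \<open>eps / 2\<close>. The bound holds for each single parameter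
  \<open>x\<close>, hence also for averages over a negligible set of \<open>x\<close> such as the
  words omitting a letter.\<close>

lemma uniform_subspace:
  assumes k: "0 < k" and "0 < eps"
  shows "\<exists>n E. mean_on (templates k m n) E \<and> (\<forall>x\<in>words k m. \<forall>g. (\<forall>w\<in>words k n. 0 \<le> g w \<and> g w \<le> 1) \<longrightarrow>
    avg k n g - eps \<le> E (\<lambda>p. g (fill p x)))"
  using \<open>0 < eps\<close>
proof (induction m arbitrary: eps)
  case 0
  then show ?case
    by (intro exI[of _ 0] exI[of _ "\<lambda>h. h []"]) (auto simp: mean_on_def fill_def)
next
  case (Suc m)
  have e2: "0 < eps / 2" using Suc.prems by simp
  obtain n E where ME: "mean_on (templates k m n) E \<and>
      (\<forall>x\<in>words k m. \<forall>g. (\<forall>w\<in>words k n. 0 \<le> g w \<and> g w \<le> 1) \<longrightarrow>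
        avg k n g - eps / 2 \<le> E (\<lambda>p. g (fill p x)))"
    using Suc.IH[OF e2] by (elim exE)
  then have M: "mean_on (templates k m n) E" by (rule conjunct1)
  have E: "avg k n g - eps / 2 \<le> E (\<lambda>p. g (fill p x))"
    if "x \<in> words k m" "\<And>w. w \<in> words k n \<Longrightarrow> 0 \<le> g w \<and> g w \<le> 1" for x g
    using ME[THEN conjunct2, THEN bspec, OF that(1), THEN spec, of g] that(2) by simp
  obtain l F where NF: "mean_on (templates k 1 l) F \<and>
      (\<forall>a<k. \<forall>g. (\<forall>w\<in>words k l. 0 \<le> g w \<and> g w \<le> 1) \<longrightarrow>
        avg k l g - eps / 2 \<le> F (\<lambda>p. g (fill p [a])))"
    using uniform_line[OF k e2] by (elim exE)
  then have N: "mean_on (templates k 1 l) F" by (rule conjunct1)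
  have F: "avg k l g - eps / 2 \<le> F (\<lambda>p. g (fill p [a]))"
    if "a < k" "\<And>w. w \<in> words k l \<Longrightarrow> 0 \<le> g w \<and> g w \<le> 1" for a g
    using NF[THEN conjunct2, rule_format, OF that(1), of g] that(2) by simp
  define G where "G h = E (\<lambda>p. F (\<lambda>q. h (join q p)))" for h :: "(nat + nat) list \<Rightarrow> real"
  have G: "mean_on (templates k (Suc m) (l + n)) G"
    unfolding mean_on_def
  proof (intro conjI allI impI)
    fix f :: "(nat + nat) list \<Rightarrow> real" assume *: "\<forall>p\<in>templates k (Suc m) (l + n). 0 \<le> f p"
    show "0 \<le> G f" unfolding G_def
      by (intro mean_nonneg[OF M] mean_nonneg[OF N] *[rule_format] join_in_templates)
  qed (simp_all add: G_def mean_add[OF M] mean_add[OF N] mean_cmult[OF M] mean_cmult[OF N]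
      mean_one[OF M] mean_one[OF N])
  have "avg k (l + n) g - eps \<le> G (\<lambda>p. g (fill p x))"
    if x: "x \<in> words k (Suc m)" and g: "\<And>w. w \<in> words k (l + n) \<Longrightarrow> 0 \<le> g w \<and> g w \<le> 1" for x g
  proof -
    obtain a z where az: "x = a # z" "a < k" "z \<in> words k m" using x by (auto simp: words_Suc_eq)
    \<comment> \<open>The first block is averaged out to apply the induction hypothesis, and then
      replaced by the random line.\<close>
    define g' where "g' v = avg k l (\<lambda>u. g (u @ v))" for v
    have g': "0 \<le> g' v \<and> g' v \<le> 1" if "v \<in> words k n" for v
      unfolding g'_def using g[OF append_in_words[OF _ that]]
      by (auto intro!: mean_nonneg[OF mean_avg[OF k]] mean_le_const[OF mean_avg[OF k]])
    have "avg k n g' - eps / 2 \<le> E (\<lambda>p. g' (fill p z))"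
      by (rule E[OF az(3) g'])
    also have "\<dots> - eps / 2 = E (\<lambda>p. g' (fill p z) - eps / 2)"
      by (simp add: mean_diff[OF M] mean_const[OF M])
    also have "\<dots> \<le> E (\<lambda>p. F (\<lambda>q. g (fill q [a] @ fill p z)))"
    proof (rule mean_mono[OF M])
      fix p assume p: "p \<in> templates k m n"
      show "g' (fill p z) - eps / 2 \<le> F (\<lambda>q. g (fill q [a] @ fill p z))"
        unfolding g'_def by (rule F[OF az(2)]) (rule g[OF append_in_words[OF _ fill_in_words[OF p az(3)]]])
    qed
    also have "\<dots> = G (\<lambda>p. g (fill p x))"
      unfolding G_def az(1) by (intro mean_cong[OF M] mean_cong[OF N]) (simp add: fill_join)
    finally have "avg k n g' - eps \<le> G (\<lambda>p. g (fill p x))" by simp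
    moreover have "avg k n g' = avg k (l + n) g"
      unfolding avg_append g'_def by (rule mean_avg_swap[OF mean_avg[OF k]])
    ultimately show ?thesis by simp
  qed
  then show ?case
    by (intro exI[of _ "l + n"] exI[of _ G] conjI[OF G] ballI allI impI) blast
qed


section \<open>Insensitive sets\<close>

definition collapse :: "nat \<Rightarrow> nat \<Rightarrow> nat list \<Rightarrow> nat list" where
  "collapse k r x = map (\<lambda>a. if a = k then r else a) x"

text \<open>Over the alphabet \<open>{..k}\<close>: membership does not change when letters \<open>k\<close> and \<open>r\<close> are swapped.\<close>

definition insens :: "nat \<Rightarrow> nat \<Rightarrow> nat \<Rightarrow> nat list set \<Rightarrow> bool" where
  "insens k r n D \<longleftrightarrow> (\<forall>x\<in>words (Suc k) n. x \<in> D \<longleftrightarrow> collapse k r x \<in> D)"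

lemma collapse_in_words:
  assumes "x \<in> words (Suc k) n" "r < k"
  shows "collapse k r x \<in> words k n"
  using assms by (auto simp: words_def collapse_def less_Suc_eq)

lemma collapse_self [simp]: "collapse k k x = x"
  by (simp add: collapse_def)

lemma length_collapse [simp]: "length (collapse k r x) = length x"
  by (simp add: collapse_def)

lemma collapse_append [simp]: "collapse k r (x @ y) = collapse k r x @ collapse k r y"
  by (simp add: collapse_def)

lemma collapse_Nil [simp]: "collapse k r [] = []"
  and collapse_Cons [simp]: "collapse k r (a # x) = (if a = k then r else a) # collapse k r x"
  by (simp_all add: collapse_def)

text \<open>The constants of \<open>p\<close> lie below \<open>k\<close>, so collapsing affects only
  letters that come from wildcards.\<close>

lemma fill_collapse:
  assumes "p \<in> templates k m n" "length z = m"
  shows "fill p (collapse k r z) = collapse k r (fill p z)"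
proof -
  have "case_sum (\<lambda>a. a) (\<lambda>j. collapse k r z ! j) e
      = (if case_sum (\<lambda>a. a) (\<lambda>j. z ! j) e = k then r else case_sum (\<lambda>a. a) (\<lambda>j. z ! j) e)"
    if "e \<in> set p" for e
  proof -
    have "e \<in> Inl ` {..<k} \<union> Inr ` {..<m}" using assms that by (auto simp: templates_def)
    then show ?thesis using assms(2) by (auto simp: collapse_def)
  qed
  then show ?thesis by (simp add: fill_def collapse_def[of k r "map _ p"])
qed

text \<open>Here \<open>p\<close> may contain the constant \<open>k\<close>; the outer collapse
  removes it on both sides.\<close>

lemma collapse_fill_collapse:
  assumes "p \<in> templates k' m n" "length z = m" "r \<noteq> k"
  shows "collapse k r (fill p (collapse k r z)) = collapse k r (fill p z)"
proof -
  have "(if case_sum (\<lambda>a. a) (\<lambda>j. collapse k r z ! j) e = k then r else case_sum (\<lambda>a. a) (\<lambda>j. collapse k r z ! j) e)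
      = (if case_sum (\<lambda>a. a) (\<lambda>j. z ! j) e = k then r else case_sum (\<lambda>a. a) (\<lambda>j. z ! j) e)"
    if "e \<in> set p" for e
  proof -
    have "e \<in> Inl ` {..<k'} \<union> Inr ` {..<m}" using assms that by (auto simp: templates_def)
    then show ?thesis using assms(2,3) by (auto simp: collapse_def)
  qed
  then show ?thesis by (simp add: fill_def collapse_def[of k r "map _ p"])
qed

lemma insens_fill:
  assumes D: "insens k r n D" and p: "p \<in> templates (Suc k) m n" and r: "r < k"
  shows "insens k r m {z. fill p z \<in> D}"
  unfolding insens_def
proof
  fix z assume z: "z \<in> words (Suc k) m"
  have cz: "collapse k r z \<in> words (Suc k) m"
    using collapse_in_words[OF z r] by (rule words_mono) simp
  have "fill p z \<in> D \<longleftrightarrow> collapse k r (fill p z) \<in> D"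
    using D fill_in_words[OF p z] by (simp add: insens_def)
  also have "collapse k r (fill p z) = collapse k r (fill p (collapse k r z))"
    using collapse_fill_collapse[OF p words_length[OF z]] r by simp
  also have "\<dots> \<in> D \<longleftrightarrow> fill p (collapse k r z) \<in> D"
    using D fill_in_words[OF p cz] by (simp add: insens_def)
  finally show "z \<in> {z. fill p z \<in> D} \<longleftrightarrow> collapse k r z \<in> {z. fill p z \<in> D}" by simp
qed

lemma insens_section:
  assumes D: "insens k r (a + n) D" and x: "x \<in> words (Suc k) a" and r: "r < k"
  shows "insens k r n {y. x @ y \<in> D}"
proof -
  have p: "map Inl x @ map Inr [0..<n] \<in> templates (Suc k) n (a + n)"
    by (rule prefix_in_templates[OF x id_in_templates])
  have "fill (map Inl x @ map Inr [0..<n]) y = x @ y" if "length y = n" for y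
    using that by (simp add: fill_append fill_id)
  then show ?thesis using insens_fill[OF D p r] by (simp add: insens_def words_length)
qed

text \<open>Words omitting the letter \<open>k\<close> are too rare to see the density of
  \<open>D\<close> directly. As parameters of a random \<open>N\<close>-dimensional subspace,
  however, each of them gives a point of \<open>D\<close> with probability at least
  \<open>d / 2\<close>. The theorem for \<open>k\<close> letters yields a subspace whose points with
  parameters below \<open>k\<close> lie in \<open>D\<close>, and insensitivity adds its other
  points.\<close>

lemma insens_contains_subspace:
  assumes r: "r < k" and line: "\<And>d. 0 < d \<Longrightarrow> \<exists>n. hj k 1 d n" and "0 < d"
  shows "\<exists>n. \<forall>D. insens k r n D \<longrightarrow> d \<le> avg (Suc k) n (\<lambda>w. of_bool (w \<in> D)) \<longrightarrow>
    (\<exists>p\<in>templates (Suc k) m n. \<forall>z\<in>words (Suc k) m. fill p z \<in> D)"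
proof -
  have k: "0 < k" using r by simp
  have d2: "0 < d / 2" using \<open>0 < d\<close> by simp
  obtain N where N: "hj k m (d / 2) N" using hj_multi[OF k line d2] by blast
  obtain n E where nE: "mean_on (templates (Suc k) N n) E \<and> (\<forall>x\<in>words (Suc k) N.
      \<forall>g. (\<forall>w\<in>words (Suc k) n. 0 \<le> g w \<and> g w \<le> 1) \<longrightarrow> avg (Suc k) n g - d / 2 \<le> E (\<lambda>p. g (fill p x)))"
    using uniform_subspace[of "Suc k" _ N, OF zero_less_Suc d2] by (elim exE)
  then have M: "mean_on (templates (Suc k) N n) E" by (rule conjunct1)
  have "\<exists>p\<in>templates (Suc k) m n. \<forall>z\<in>words (Suc k) m. fill p z \<in> D"
    if D: "insens k r n D" and dD: "d \<le> avg (Suc k) n (\<lambda>w. of_bool (w \<in> D))" for D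
  proof -
    have "d / 2 \<le> E (\<lambda>p. of_bool (fill p x \<in> D))" if "x \<in> words k N" for x
      using nE[THEN conjunct2, rule_format, OF words_mono[OF that], of "\<lambda>w. of_bool (w \<in> D)"] dD by simp
    then have "d / 2 \<le> avg k N (\<lambda>x. E (\<lambda>p. of_bool (fill p x \<in> D)))"
      by (rule mean_ge_const[OF mean_avg[OF k]])
    also have "\<dots> = E (\<lambda>p. avg k N (\<lambda>x. of_bool (fill p x \<in> D)))"
      by (rule mean_avg_swap[OF M, symmetric])
    finally have "\<exists>p\<in>templates (Suc k) N n. d / 2 \<le> avg k N (\<lambda>x. of_bool (fill p x \<in> D))"
      by (rule mean_exists_ge[OF M _ finite_templates])
    then obtain p where p: "p \<in> templates (Suc k) N n" "d / 2 \<le> avg k N (\<lambda>x. of_bool (x \<in> {x. fill p x \<in> D}))"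
      by auto
    then obtain q where q: "q \<in> templates k m N" "\<forall>z\<in>words k m. fill q z \<in> {x. fill p x \<in> D}"
      using N unfolding hj_def by blast
    have q': "q \<in> templates (Suc k) m N" using templates_mono[OF q(1)] by simp
    have "fill (subst_template p q) z \<in> D" if z: "z \<in> words (Suc k) m" for z
    proof -
      have "fill p (fill q (collapse k r z)) \<in> D" using q(2) collapse_in_words[OF z r] by blast
      then have "fill p (collapse k r (fill q z)) \<in> D"
        by (simp add: fill_collapse[OF q(1) words_length[OF z]])
      then have "fill p (fill q z) \<in> D"
        using insens_fill[OF D p(1) r] fill_in_words[OF q' z] by (simp add: insens_def)
      moreover have "length q = N" using q by (simp add: templates_def)
      ultimately show ?thesis by (simp add: fill_subst_template[OF p(1)])
    qed
    then show ?thesis using subst_template_in_templates[OF p(1) q'] by blast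
  qed
  then show ?thesis by blast
qed

section \<open>Intersections of insensitive sets are almost unions of subspaces\<close>

text \<open>
  Instead of tiling a set \<open>D\<close> by disjoint subspaces we use the dual statement: a function whose
  average over every subspace contained in \<open>D\<close> is nonpositive has a small integral over \<open>D\<close>.
\<close>

definition nonpos_on_subspaces :: "nat \<Rightarrow> nat \<Rightarrow> nat \<Rightarrow> nat list set \<Rightarrow> (nat list \<Rightarrow> real) \<Rightarrow> bool" where
  "nonpos_on_subspaces k m n D f \<longleftrightarrow>
     (\<forall>p\<in>templates k m n. (\<forall>z\<in>words k m. fill p z \<in> D) \<longrightarrow> avg k m (\<lambda>z. f (fill p z)) \<le> 0)"

lemma avg_subspace:
  assumes p: "p \<in> templates k m n"
  shows "avg k n (\<lambda>x. of_bool (x \<in> fill p ` words k m) * h x) = avg k m (\<lambda>z. h (fill p z)) * k ^ m / k ^ n"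
proof -
  have "fill p ` words k m \<subseteq> words k n" using fill_in_words[OF p] by auto
  then have "(\<Sum>x\<in>words k n. of_bool (x \<in> fill p ` words k m) * h x) = (\<Sum>x\<in>fill p ` words k m. h x)"
    by (intro sum.mono_neutral_cong_right) auto
  also have "\<dots> = (\<Sum>z\<in>words k m. h (fill p z))"
    using fill_inj[OF p] by (simp add: sum.reindex)
  also have "\<dots> = avg k m (\<lambda>z. h (fill p z)) * k ^ m"
  \<comment> \<open>In this case \<open>avg\<close> divides by zero, but there are no words to sum
    over.\<close>
  proof (cases "k = 0 \<and> 0 < m")
    case True
    then have "words k m = {}" by (auto simp: words_def)
    then show ?thesis by (simp add: avg_def)
  qed (auto simp: avg_def)
  finally show ?thesis by (simp add: avg_def)
qed

text \<open>One template \<open>p\<close> serves all \<open>y\<close> of a dense set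
  \<open>R\<close>, so the subspaces formed by \<open>V\<close> and a fixed \<open>y\<close> can be
  removed from \<open>D\<close> all at once. On each of them \<open>f\<close> has nonpositive
  average; the sections \<open>D' x\<close> of the remainder fall under \<open>IH\<close>, with
  total density smaller by at least \<open>rho\<close>. The error \<open>b\<close> does not grow
  because it is averaged over \<open>x\<close>.\<close>

lemma insens_decay_step:
  assumes r: "r < k"
    and N: "\<And>D. insens k r N D \<Longrightarrow> b / 2 \<le> avg (Suc k) N (\<lambda>w. of_bool (w \<in> D)) \<Longrightarrow>
      \<exists>p\<in>templates (Suc k) m N. \<forall>z\<in>words (Suc k) m. fill p z \<in> D"
    and b: "0 < b" and rho: "rho = b / 2 / card (templates (Suc k) m N) / Suc k ^ N"
    and IH: "\<And>D f. insens k r n D \<Longrightarrow> (\<And>x. x \<in> words (Suc k) n \<Longrightarrow> f x \<le> 1) \<Longrightarrow>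
      nonpos_on_subspaces (Suc k) m n D f \<Longrightarrow>
      avg (Suc k) n (\<lambda>x. of_bool (x \<in> D) * f x) \<le> b + L * avg (Suc k) n (\<lambda>x. of_bool (x \<in> D))"
    and L: "0 \<le> L"
    and D: "insens k r (N + n) D" and f: "\<And>x. x \<in> words (Suc k) (N + n) \<Longrightarrow> f x \<le> 1"
    and nonpos: "nonpos_on_subspaces (Suc k) m (N + n) D f"
    and dense: "b \<le> avg (Suc k) (N + n) (\<lambda>x. of_bool (x \<in> D))"
  shows "avg (Suc k) (N + n) (\<lambda>x. of_bool (x \<in> D) * f x)
    \<le> b + (1 - rho) * L * avg (Suc k) (N + n) (\<lambda>x. of_bool (x \<in> D))"
proof -
  define K where "K = Suc k"
  note M = mean_avg[of K, unfolded K_def, OF zero_less_Suc, folded K_def]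
  have "\<exists>p\<in>templates K m N. b / 2 / card (templates K m N)
      \<le> avg K n (\<lambda>y. of_bool (\<forall>z\<in>words K m. fill p z @ y \<in> D))"
  proof (rule mean_pigeonhole[OF M])
    show "b \<le> avg K n (\<lambda>y. avg K N (\<lambda>x. of_bool (x @ y \<in> D)))"
      using dense unfolding avg_append K_def[symmetric] by (subst mean_avg_swap[OF M])
    show "avg K N (\<lambda>x. of_bool (x @ y \<in> D)) \<le> 1" for y
      by (rule mean_le_const[OF M]) simp
    fix y assume y: "y \<in> words K n" and "b / 2 \<le> avg K N (\<lambda>x. of_bool (x @ y \<in> D))"
    moreover have "insens k r N {x. x @ y \<in> D}"
    proof -
      have p: "map Inr [0..<N] @ map Inl y \<in> templates (Suc k) N (N + n)"
        using suffix_in_templates[OF _ id_in_templates] y by (simp add: K_def)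
      have "fill (map Inr [0..<N] @ map Inl y) x = x @ y" if "length x = N" for x
        using that by (simp add: fill_append fill_id)
      then show ?thesis using insens_fill[OF D p r] by (simp add: insens_def words_length)
    qed
    ultimately show "\<exists>p\<in>templates K m N. \<forall>z\<in>words K m. fill p z @ y \<in> D"
      using N[of "{x. x @ y \<in> D}"] by (simp add: K_def)
  qed (use b in auto)
  then obtain p where p: "p \<in> templates K m N"
    and pR: "b / 2 / card (templates K m N) \<le> avg K n (\<lambda>y. of_bool (\<forall>z\<in>words K m. fill p z @ y \<in> D))"
    by blast
  define R where "R y \<longleftrightarrow> (\<forall>z\<in>words K m. fill p z @ y \<in> D)" for y
  define V where "V = fill p ` words K m"
  define D' where "D' x = {y. x @ y \<in> D \<and> \<not> (x \<in> V \<and> R y)}" for x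
  have VR: "x @ y \<in> D" if "x \<in> V" "R y" for x y
    using that by (auto simp: V_def R_def)
  \<comment> \<open>\<open>R\<close> is insensitive as an intersection of sections of
    \<open>D\<close>; therefore the sections \<open>D' x\<close> stay insensitive.\<close>
  have Rcollapse: "R y \<longleftrightarrow> R (collapse k r y)" if y: "y \<in> words K n" for y
    unfolding R_def
  proof (rule ball_cong[OF refl])
    fix z assume "z \<in> words K m"
    then have "fill p z \<in> words (Suc k) N" using fill_in_words[OF p] by (simp add: K_def)
    from insens_section[OF D this r] show "fill p z @ y \<in> D \<longleftrightarrow> fill p z @ collapse k r y \<in> D"
      using y by (simp add: insens_def K_def)
  qed
  have part1: "avg K n (\<lambda>y. of_bool (y \<in> D' x) * f (x @ y)) \<le> b + L * avg K n (\<lambda>y. of_bool (y \<in> D' x))"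
    if x: "x \<in> words K N" for x
    unfolding K_def
  proof (rule IH)
    show "insens k r n (D' x)"
      using insens_section[OF D x[unfolded K_def] r] Rcollapse by (auto simp: insens_def D'_def K_def)
    show "f (x @ y) \<le> 1" if "y \<in> words (Suc k) n" for y
      using f append_in_words x that by (simp add: K_def)
    show "nonpos_on_subspaces (Suc k) m n (D' x) (\<lambda>y. f (x @ y))"
      unfolding nonpos_on_subspaces_def
    proof (intro ballI impI)
      fix q assume q: "q \<in> templates (Suc k) m n" "\<forall>z\<in>words (Suc k) m. fill q z \<in> D' x"
      have "map Inl x @ q \<in> templates (Suc k) m (N + n)"
        using prefix_in_templates[OF _ q(1)] x by (simp add: K_def)
      then show "avg (Suc k) m (\<lambda>z. f (x @ fill q z)) \<le> 0"
        using nonpos[unfolded nonpos_on_subspaces_def, rule_format, of "map Inl x @ q"] q(2)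
        by (simp add: fill_append D'_def)
    qed
  qed
  have part2: "of_bool (R y) * avg K N (\<lambda>x. of_bool (x \<in> V) * f (x @ y)) \<le> 0" if y: "y \<in> words K n" for y
  proof (cases "R y")
    case True
    have "p @ map Inl y \<in> templates (Suc k) m (N + n)"
      using suffix_in_templates[OF y p] by (simp add: K_def)
    then have "avg K m (\<lambda>z. f (fill p z @ y)) \<le> 0"
      using nonpos[unfolded nonpos_on_subspaces_def, rule_format, of "p @ map Inl y"] True
      by (simp add: fill_append R_def K_def)
    then show ?thesis unfolding V_def avg_subspace[OF p]
      by (simp add: mult_nonpos_nonneg divide_nonpos_nonneg)
  qed simp
  \<comment> \<open>Counting \<open>V\<close> as a single word is enough for the value of
    \<open>rho\<close>.\<close>
  have VR_avg: "rho \<le> avg K N (\<lambda>x. of_bool (x \<in> V)) * avg K n (\<lambda>y. of_bool (R y))"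
  proof -
    have "avg K N (\<lambda>x. of_bool (x \<in> V)) = K ^ m / K ^ N"
      using avg_subspace[OF p, of "\<lambda>_. 1"] by (simp add: V_def mean_one[OF M])
    moreover have "1 / real (K ^ N) \<le> K ^ m / K ^ N"
      by (intro divide_right_mono) (auto simp: K_def)
    ultimately have "1 / real (K ^ N) \<le> avg K N (\<lambda>x. of_bool (x \<in> V))" by simp
    then have "1 / real (K ^ N) * (b / 2 / card (templates K m N)) \<le> avg K N (\<lambda>x. of_bool (x \<in> V)) * avg K n (\<lambda>y. of_bool (R y))"
      using pR b by (intro mult_mono) (auto simp: R_def intro: order_trans[of 0 "1 / real (K ^ N)"])
    then show ?thesis by (simp add: rho K_def mult_ac)
  qed
  define d where "d = avg K (N + n) (\<lambda>x. of_bool (x \<in> D))"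
  have d1: "d \<le> 1" unfolding d_def by (rule mean_le_const[OF M]) simp
  have d_eq: "avg K N (\<lambda>x. avg K n (\<lambda>y. of_bool (y \<in> D' x)))
      = d - avg K N (\<lambda>x. of_bool (x \<in> V)) * avg K n (\<lambda>y. of_bool (R y))"
  proof -
    have "avg K N (\<lambda>x. avg K n (\<lambda>y. of_bool (y \<in> D' x)))
        = avg K N (\<lambda>x. avg K n (\<lambda>y. of_bool (x @ y \<in> D) - of_bool (x \<in> V) * of_bool (R y)))"
      using VR by (intro avg_cong) (auto simp: D'_def)
    also have "\<dots> = d - avg K N (\<lambda>x. of_bool (x \<in> V) * avg K n (\<lambda>y. of_bool (R y)))"
      unfolding d_def avg_append by (simp only: mean_diff[OF M] mean_cmult[OF M])
    also have "avg K N (\<lambda>x. of_bool (x \<in> V) * avg K n (\<lambda>y. of_bool (R y)))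
        = avg K N (\<lambda>x. of_bool (x \<in> V)) * avg K n (\<lambda>y. of_bool (R y))"
      using mean_cmult[OF M, where c = "avg K n (\<lambda>y. of_bool (R y))" and f = "\<lambda>x. of_bool (x \<in> V)"]
      by (simp only: mult.commute)
    finally show ?thesis .
  qed
  have "avg K (N + n) (\<lambda>x. of_bool (x \<in> D) * f x)
      = avg K N (\<lambda>x. avg K n (\<lambda>y. of_bool (y \<in> D' x) * f (x @ y) + of_bool (R y) * (of_bool (x \<in> V) * f (x @ y))))"
    unfolding avg_append using VR by (intro avg_cong) (auto simp: D'_def)
  also have "\<dots> = avg K N (\<lambda>x. avg K n (\<lambda>y. of_bool (y \<in> D' x) * f (x @ y)))
      + avg K n (\<lambda>y. of_bool (R y) * avg K N (\<lambda>x. of_bool (x \<in> V) * f (x @ y)))"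
    unfolding mean_add[OF M] mean_cmult[OF M, symmetric]
    by (subst (2) mean_avg_swap[OF M]) (rule refl)
  also have "\<dots> \<le> avg K N (\<lambda>x. b + L * avg K n (\<lambda>y. of_bool (y \<in> D' x))) + 0"
    by (intro add_mono mean_mono[OF M] mean_le_const[OF M] part1 part2)
  also have "\<dots> = b + L * (d - avg K N (\<lambda>x. of_bool (x \<in> V)) * avg K n (\<lambda>y. of_bool (R y)))"
    by (simp add: mean_add[OF M] mean_cmult[OF M] mean_const[OF M] d_eq)
  \<comment> \<open>As \<open>d \<le> 1\<close>, removing density \<open>rho\<close> removes at
    least the fraction \<open>rho\<close> of \<open>D\<close>.\<close>
  also have "\<dots> \<le> b + L * (d - rho * d)"
  proof -
    have "0 \<le> rho" using b by (simp add: rho)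
    then have "rho * d \<le> rho" using d1 by (simp add: mult_left_le)
    then show ?thesis using VR_avg L by (intro add_left_mono mult_left_mono) linarith+
  qed
  finally show ?thesis by (simp add: d_def K_def algebra_simps)
qed


text \<open>Iterating \<open>insens_decay_step\<close> with \<open>L = (1 - rho) ^ t\<close> shrinks
  the coefficient below \<open>b / 2\<close>. If the density of \<open>D\<close> is below
  \<open>b / 2\<close> at some stage, then \<open>f \<le> 1\<close> already suffices.\<close>

lemma insens_tiling:
  assumes r: "r < k" and line: "\<And>d. 0 < d \<Longrightarrow> \<exists>n. hj k 1 d n" and b: "0 < b" "b \<le> 1"
  shows "\<exists>n0. \<forall>n\<ge>n0. \<forall>D f. insens k r n D \<longrightarrow> (\<forall>x\<in>words (Suc k) n. f x \<le> 1) \<longrightarrow>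
    nonpos_on_subspaces (Suc k) m n D f \<longrightarrow> avg (Suc k) n (\<lambda>x. of_bool (x \<in> D) * f x) \<le> b"
proof -
  define c where "c = b / 2"
  note M = mean_avg[of "Suc k", OF zero_less_Suc]
  have c: "0 < c" "0 < c / 2" "c / 2 \<le> 1" using b by (auto simp: c_def)
  obtain N where N: "\<And>D. insens k r N D \<Longrightarrow> c / 2 \<le> avg (Suc k) N (\<lambda>w. of_bool (w \<in> D)) \<Longrightarrow>
      \<exists>p\<in>templates (Suc k) m N. \<forall>z\<in>words (Suc k) m. fill p z \<in> D"
    using insens_contains_subspace[OF r line c(2), of m] by blast
  define rho where "rho = c / 2 / card (templates (Suc k) m N) / Suc k ^ N"
  \<comment> \<open>The full set is insensitive of density 1, so \<open>N\<close> yields a template;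
    without one \<open>rho\<close> would be 0.\<close>
  have "templates (Suc k) m N \<noteq> {}"
    using N[of UNIV] c by (auto simp: insens_def mean_one[OF M])
  then have card: "1 \<le> real (card (templates (Suc k) m N))"
    using finite_templates[of "Suc k" m N] by (simp add: card_gt_0_iff Suc_leI)
  have rho: "0 < rho" "rho \<le> 1"
  proof -
    show "0 < rho" unfolding rho_def using c card by simp
    have "c / 2 / card (templates (Suc k) m N) \<le> 1"
      using c card by (simp add: pos_divide_le_eq)
    also have "1 \<le> real (Suc k ^ N)" by simp
    finally show "rho \<le> 1" unfolding rho_def by (subst pos_divide_le_eq) simp_all
  qed
  \<comment> \<open>The \<open>l\<close> spare letters make the bound available at every length from
    \<open>t * N\<close> on.\<close>
  have decay: "avg (Suc k) (t * N + l) (\<lambda>x. of_bool (x \<in> D) * f x)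
      \<le> c + (1 - rho) ^ t * avg (Suc k) (t * N + l) (\<lambda>x. of_bool (x \<in> D))"
    if "insens k r (t * N + l) D" "\<And>x. x \<in> words (Suc k) (t * N + l) \<Longrightarrow> f x \<le> 1"
      "nonpos_on_subspaces (Suc k) m (t * N + l) D f" for t l D f
    using that
  proof (induction t arbitrary: D f)
    case 0
    have "avg (Suc k) (0 * N + l) (\<lambda>x. of_bool (x \<in> D) * f x) \<le> avg (Suc k) (0 * N + l) (\<lambda>x. of_bool (x \<in> D))"
      using 0 by (intro mean_mono[OF M]) auto
    then show ?case using c by simp
  next
    case (Suc t)
    have eq: "Suc t * N + l = N + (t * N + l)" by simp
    show ?case
    proof (cases "c \<le> avg (Suc k) (Suc t * N + l) (\<lambda>x. of_bool (x \<in> D))")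
      case True
      have "avg (Suc k) (Suc t * N + l) (\<lambda>x. of_bool (x \<in> D) * f x)
          \<le> c + (1 - rho) * (1 - rho) ^ t * avg (Suc k) (Suc t * N + l) (\<lambda>x. of_bool (x \<in> D))"
        using Suc.prems True rho unfolding eq
        by (intro insens_decay_step[OF r N c(1) rho_def Suc.IH]) auto
      then show ?thesis by simp
    next
      case False
      have "avg (Suc k) (Suc t * N + l) (\<lambda>x. of_bool (x \<in> D) * f x) \<le> avg (Suc k) (Suc t * N + l) (\<lambda>x. of_bool (x \<in> D))"
        using Suc.prems(2) by (intro mean_mono[OF M]) auto
      also have "\<dots> \<le> c + 0" using False by simp
      also have "\<dots> \<le> c + (1 - rho) ^ Suc t * avg (Suc k) (Suc t * N + l) (\<lambda>x. of_bool (x \<in> D))"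
        using rho by (intro add_left_mono mult_nonneg_nonneg mean_nonneg[OF M]) auto
      finally show ?thesis .
    qed
  qed
  obtain t where t: "(1 - rho) ^ t < c"
    using real_arch_pow_inv[OF c(1), of "1 - rho"] rho by auto
  have "avg (Suc k) n (\<lambda>x. of_bool (x \<in> D) * f x) \<le> b"
    if "t * N \<le> n" "insens k r n D" "\<And>x. x \<in> words (Suc k) n \<Longrightarrow> f x \<le> 1"
      "nonpos_on_subspaces (Suc k) m n D f" for n D f
  proof -
    have n: "t * N + (n - t * N) = n" using that(1) by simp
    have "avg (Suc k) n (\<lambda>x. of_bool (x \<in> D) * f x)
        \<le> c + (1 - rho) ^ t * avg (Suc k) n (\<lambda>x. of_bool (x \<in> D))"
      using decay[of t "n - t * N" D f, unfolded n, OF that(2-4)] .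
    also have "\<dots> \<le> c + (1 - rho) ^ t * 1"
      using rho by (intro add_left_mono mult_left_mono mean_le_const[OF M]) auto
    finally show ?thesis using t by (simp add: c_def)
  qed
  then show ?thesis by (intro exI[of _ "t * N"]) auto
qed

text \<open>Inside an \<open>n1\<close>-dimensional subspace of the first \<open>j\<close> sets,
  \<open>insens_tiling\<close> bounds the integral of \<open>f\<close> over the last set by
  \<open>b / 2\<close>. This makes \<open>g\<close> nonpositive on such subspaces, and the induction
  hypothesis for dimension \<open>n1\<close> applies to \<open>g\<close>.\<close>

lemma insens_Inter_tiling:
  assumes line: "\<And>d. 0 < d \<Longrightarrow> \<exists>n. hj k 1 d n" and "j \<le> k" and b: "0 < b" "b \<le> 1"
  shows "\<exists>n0. \<forall>n\<ge>n0. \<forall>D f. (\<forall>i<j. insens k i n (D i)) \<longrightarrow> (\<forall>x\<in>words (Suc k) n. f x \<le> 1) \<longrightarrow>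
    nonpos_on_subspaces (Suc k) m n {x. \<forall>i<j. x \<in> D i} f \<longrightarrow>
    avg (Suc k) n (\<lambda>x. of_bool (\<forall>i<j. x \<in> D i) * f x) \<le> b"
  using \<open>j \<le> k\<close> b
proof (induction j arbitrary: m b)
  case 0
  note M = mean_avg[of "Suc k", OF zero_less_Suc]
  have "avg (Suc k) n f \<le> b" if n: "m \<le> n" and f: "nonpos_on_subspaces (Suc k) m n UNIV f" for n f
  proof -
    \<comment> \<open>Fixing the first \<open>n - m\<close> letters partitions the whole space into
      \<open>m\<close>-dimensional subspaces.\<close>
    have eq: "n = (n - m) + m" using n by simp
    have "avg (Suc k) m (\<lambda>z. f (x @ z)) \<le> 0" if x: "x \<in> words (Suc k) (n - m)" for x
    proof -
      have "map Inl x @ map Inr [0..<m] \<in> templates (Suc k) m n"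
        using prefix_in_templates[OF x id_in_templates, of m] unfolding eq[symmetric] .
      then have "avg (Suc k) m (\<lambda>z. f (fill (map Inl x @ map Inr [0..<m]) z)) \<le> 0"
        using f by (simp add: nonpos_on_subspaces_def)
      also have "avg (Suc k) m (\<lambda>z. f (fill (map Inl x @ map Inr [0..<m]) z)) = avg (Suc k) m (\<lambda>z. f (x @ z))"
        by (rule avg_cong) (simp add: fill_append fill_id words_length)
      finally show ?thesis .
    qed
    then have "avg (Suc k) n f \<le> 0"
      by (subst eq, subst avg_append) (rule mean_le_const[OF M])
    then show ?thesis using \<open>0 < b\<close> by simp
  qed
  then show ?case by (intro exI[of _ m]) auto
next
  case (Suc j)
  note M = mean_avg[of "Suc k", OF zero_less_Suc]
  have j: "j < k" "j \<le> k" and b2: "0 < b / 2" "b / 2 \<le> 1" using Suc.prems by auto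
  obtain n1 where n1: "\<And>n D f. n1 \<le> n \<Longrightarrow> insens k j n D \<Longrightarrow> (\<forall>x\<in>words (Suc k) n. f x \<le> 1) \<Longrightarrow>
      nonpos_on_subspaces (Suc k) m n D f \<Longrightarrow> avg (Suc k) n (\<lambda>x. of_bool (x \<in> D) * f x) \<le> b / 2"
    using insens_tiling[OF j(1) line b2, of m] by meson
  obtain n0 where n0: "\<And>n D f. n0 \<le> n \<Longrightarrow> (\<forall>i<j. insens k i n (D i)) \<Longrightarrow> (\<forall>x\<in>words (Suc k) n. f x \<le> 1) \<Longrightarrow>
      nonpos_on_subspaces (Suc k) n1 n {x. \<forall>i<j. x \<in> D i} f \<Longrightarrow>
      avg (Suc k) n (\<lambda>x. of_bool (\<forall>i<j. x \<in> D i) * f x) \<le> b / 2"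
    using Suc.IH[OF j(2) b2, of n1] by meson
  have "avg (Suc k) n (\<lambda>x. of_bool (\<forall>i<Suc j. x \<in> D i) * f x) \<le> b"
    if n: "n0 \<le> n" and D: "\<forall>i<Suc j. insens k i n (D i)" and f: "\<forall>x\<in>words (Suc k) n. f x \<le> 1"
      and nonpos: "nonpos_on_subspaces (Suc k) m n {x. \<forall>i<Suc j. x \<in> D i} f" for n D f
  proof -
    define g where "g x = of_bool (x \<in> D j) * f x - b / 2" for x
    have "avg (Suc k) n (\<lambda>x. of_bool (\<forall>i<j. x \<in> D i) * g x) \<le> b / 2"
    proof (rule n0[OF n])
      show "\<forall>x\<in>words (Suc k) n. g x \<le> 1" using f b2 by (auto simp: g_def)
      show "nonpos_on_subspaces (Suc k) n1 n {x. \<forall>i<j. x \<in> D i} g"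
        unfolding nonpos_on_subspaces_def
      proof (intro ballI impI)
        fix p assume p: "p \<in> templates (Suc k) n1 n" and pD: "\<forall>z\<in>words (Suc k) n1. fill p z \<in> {x. \<forall>i<j. x \<in> D i}"
        have "avg (Suc k) n1 (\<lambda>z. of_bool (z \<in> {z. fill p z \<in> D j}) * f (fill p z)) \<le> b / 2"
        proof (rule n1[OF order_refl])
          show "insens k j n1 {z. fill p z \<in> D j}" using insens_fill[OF _ p j(1)] D by simp
          show "\<forall>z\<in>words (Suc k) n1. f (fill p z) \<le> 1" using f fill_in_words[OF p] by blast
          show "nonpos_on_subspaces (Suc k) m n1 {z. fill p z \<in> D j} (\<lambda>z. f (fill p z))"
            unfolding nonpos_on_subspaces_def
          proof (intro ballI impI)
            fix q assume q: "q \<in> templates (Suc k) m n1" and qD: "\<forall>z\<in>words (Suc k) m. fill q z \<in> {z. fill p z \<in> D j}"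
            have eq: "fill (subst_template p q) z = fill p (fill q z)" for z
              using fill_subst_template[OF p, of q] q by (simp add: templates_def)
            have "\<forall>z\<in>words (Suc k) m. fill (subst_template p q) z \<in> {x. \<forall>i<Suc j. x \<in> D i}"
              using pD qD fill_in_words[OF q] by (auto simp: eq less_Suc_eq)
            then show "avg (Suc k) m (\<lambda>z. f (fill p (fill q z))) \<le> 0"
              using nonpos subst_template_in_templates[OF p q]
              by (simp add: nonpos_on_subspaces_def eq[symmetric])
          qed
        qed
        then show "avg (Suc k) n1 (\<lambda>z. g (fill p z)) \<le> 0"
          by (simp add: g_def mean_diff[OF M] mean_const[OF M])
      qed
    qed (use D in simp)
    moreover have "avg (Suc k) n (\<lambda>x. of_bool (\<forall>i<Suc j. x \<in> D i) * f x)
        = avg (Suc k) n (\<lambda>x. of_bool (\<forall>i<j. x \<in> D i) * g x + b / 2 * of_bool (\<forall>i<j. x \<in> D i))"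
      by (rule avg_cong) (auto simp: g_def less_Suc_eq)
    moreover have "b / 2 * avg (Suc k) n (\<lambda>x. of_bool (\<forall>i<j. x \<in> D i)) \<le> b / 2 * 1"
      using b2 by (intro mult_left_mono mean_le_const[OF M]) auto
    ultimately show ?thesis by (simp only: mean_add[OF M] mean_cmult[OF M])
  qed
  then show ?case by (intro exI[of _ n0]) auto
qed


section \<open>The density increment\<close>

lemma ball_words_1: "(\<forall>z\<in>words k 1. P z) \<longleftrightarrow> (\<forall>a<k. P [a])"
  unfolding words_1 by blast

text \<open>A word over \<open>{..k}\<close> that contains \<open>k\<close> encodes a line over
  \<open>k\<close> letters, its letters \<open>k\<close> being the wildcards.\<close>

definition wildcard :: "nat \<Rightarrow> nat list \<Rightarrow> (nat + nat) list" where
  "wildcard k x = map (\<lambda>a. if a = k then Inr 0 else Inl a) x"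

lemma fill_wildcard: "fill (wildcard k x) (a # z) = collapse k a x"
  by (simp add: fill_def wildcard_def collapse_def)

lemma set_wildcard: "x \<in> words (Suc k) n \<Longrightarrow> set (wildcard k x) \<subseteq> Inl ` {..<k} \<union> Inr ` {..<Suc m}"
  by (auto simp: wildcard_def words_def less_Suc_eq)

lemma wildcard_in_templates:
  assumes "x \<in> words (Suc k) n" "k \<in> set x"
  shows "wildcard k x \<in> templates k 1 n"
proof -
  have "Inr 0 \<in> set (wildcard k x)"
    using assms(2) unfolding wildcard_def set_map by (intro image_eqI[of _ _ k]) auto
  then show ?thesis using set_wildcard[OF assms(1), of 0] assms(1)
    by (auto simp: templates_def wildcard_def words_def)
qed

text \<open>
  Each letter \<open>a\<close> of the first word is followed by a block of length \<open>m\<close> of the second one in which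
  \<open>a\<close> replaces the letter \<open>k\<close>. Words with \<open>a = k\<close> thus keep a full block of free letters while all
  letters \<open>k\<close> of the result still move together along a line of \<open>words k n\<close>.
\<close>

fun spread :: "nat \<Rightarrow> nat \<Rightarrow> nat list \<Rightarrow> nat list \<Rightarrow> nat list" where
  "spread k m [] s = []"
| "spread k m (a # t) s = a # collapse k a (take m s) @ spread k m t (drop m s)"

lemma spread_append:
  "length s = length t * m \<Longrightarrow> spread k m (t @ t') (s @ s') = spread k m t s @ spread k m t' s'"
  by (induction t arbitrary: s) auto

text \<open>The block after a letter \<open>k\<close> is stored unchanged and gets collapsed when
  that letter becomes \<open>r\<close>; the other blocks contain no \<open>k\<close>. So lines in
  the first word carry their blocks along.\<close>

lemma collapse_spread:
  assumes "r \<noteq> k"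
  shows "collapse k r (spread k m t s) = spread k m (collapse k r t) s"
proof (induction t arbitrary: s)
  case (Cons a t)
  have "collapse k r (collapse k a u) = collapse k (if a = k then r else a) u" for u
    using assms by (simp add: collapse_def)
  then show ?case using Cons by simp
qed simp

lemma spread_in_words:
  assumes "t \<in> words K n" "s \<in> words (Suc k) (n * m)" "k \<le> K" "K \<le> Suc k"
  shows "spread k m t s \<in> words K (n * Suc m)"
  using assms(1,2)
proof (induction n arbitrary: t s)
  case (Suc n)
  obtain a t' where t: "t = a # t'" "a < K" "t' \<in> words K n" using Suc.prems(1) by (auto simp: words_Suc_eq)
  have s: "take m s \<in> words (Suc k) m" "drop m s \<in> words (Suc k) (n * m)"
    using Suc.prems(2) by (auto simp: words_def dest: in_set_takeD in_set_dropD)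
  have "collapse k a (take m s) \<in> words K m"
  proof (cases "a = k")
    case True
    then have "K = Suc k" using t assms(4) by simp
    then show ?thesis using True s by simp
  next
    case False
    then have "a < k" using t assms(4) by simp
    then show ?thesis using collapse_in_words[OF s(1)] assms(3) words_mono by blast
  qed
  then have "collapse k a (take m s) @ spread k m t' (drop m s) \<in> words K (m + n * Suc m)"
    using Suc.IH[OF t(3) s(2)] by (rule append_in_words)
  then show ?case using t by (simp add: add.left_commute[of m n "n * m"])
qed simp

text \<open>The block behind the chosen letter \<open>k\<close> is left free as wildcards
  \<open>1\<close> to \<open>m\<close>, while that letter and the letters \<open>k\<close> outside
  the block become wildcard \<open>0\<close>. All constants of \<open>W\<close> lie below
  \<open>k\<close>, so that \<open>fill W\<close> commutes with \<open>collapse\<close>.\<close>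

lemma spread_subspace:
  assumes t: "t1 @ k # t2 \<in> words (Suc k) n"
    and s1: "s1 \<in> words (Suc k) (length t1 * m)" and s2: "s2 \<in> words (Suc k) (length t2 * m)"
  shows "\<exists>W\<in>templates k (Suc m) (n * Suc m). \<forall>s\<in>words (Suc k) m.
    fill W (k # s) = spread k m (t1 @ k # t2) (s1 @ s @ s2)"
proof -
  define X1 where "X1 = spread k m t1 s1"
  define X2 where "X2 = spread k m t2 s2"
  define W where "W = wildcard k X1 @ Inr 0 # map Inr [1..<Suc m] @ wildcard k X2"
  have tt: "t1 \<in> words (Suc k) (length t1)" "t2 \<in> words (Suc k) (length t2)" and n: "n = Suc (length t1 + length t2)"
    using t by (auto simp: words_def)
  have X: "X1 \<in> words (Suc k) (length t1 * Suc m)" "X2 \<in> words (Suc k) (length t2 * Suc m)"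
    unfolding X1_def X2_def using tt s1 s2 by (auto intro: spread_in_words simp del: mult_Suc_right)
  have "length W = n * Suc m"
    using words_length[OF X(1)] words_length[OF X(2)] by (simp add: W_def wildcard_def n algebra_simps)
  moreover have "Inr ` {..<Suc m} = insert (Inr 0) (Inr ` {1..<Suc m} :: (nat + nat) set)"
    by (auto simp: image_iff)
  ultimately have "W \<in> templates k (Suc m) (n * Suc m)"
    using set_wildcard[OF X(1), of m] set_wildcard[OF X(2), of m]
    by (auto simp: templates_def W_def simp del: upt_Suc)
  moreover have "fill W (k # s) = spread k m (t1 @ k # t2) (s1 @ s @ s2)" if s: "s \<in> words (Suc k) m" for s
  proof -
    have "fill (map Inr [1..<Suc m]) (k # s) = s"
      using words_length[OF s] map_nth[of s]
      by (simp add: fill_def comp_def map_Suc_upt[symmetric] del: upt_Suc map_Suc_upt)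
    then have "fill W (k # s) = X1 @ k # s @ X2"
      unfolding W_def fill_append fill_wildcard by (simp add: fill_def fill_wildcard[unfolded fill_def] del: upt_Suc)
    also have "\<dots> = spread k m (t1 @ k # t2) (s1 @ s @ s2)"
      using words_length[OF s1] words_length[OF s] by (simp add: spread_append X1_def X2_def)
    finally show ?thesis .
  qed
  ultimately show ?thesis by blast
qed

text \<open>For every \<open>s\<close>, the theorem for \<open>k\<close> letters gives a line of
  words \<open>t\<close> whose spreads all lie in \<open>A p\<close> with probability at least
  \<open>th\<close>. One line serves many \<open>s\<close>, and fixing \<open>s\<close> outside one
  block behind a wildcard gives \<open>W\<close>. The lower bound does not involve \<open>m\<close>,
  which can therefore be chosen large afterwards.\<close>

lemma dense_line_directions:
  assumes k: "0 < k" and hj: "hj k 1 (d / 2) n" and d: "0 < d" and E: "mean_on T E"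
    and A: "\<And>x. x \<in> words k (n * Suc m) \<Longrightarrow> d \<le> E (\<lambda>p. of_bool (x \<in> A p))"
  shows "\<exists>W\<in>templates k (Suc m) (n * Suc m).
    d / 2 / card (templates k 1 n) / (2 * Suc k ^ Suc n) \<le>
    E (\<lambda>p. avg (Suc k) (Suc m) (\<lambda>x. of_bool (\<forall>a<k. fill W (collapse k a x) \<in> A p)))"
proof -
  define th where "th = d / 2 / card (templates k 1 n)"
  have th: "0 \<le> th" using d by (simp add: th_def)
  note M = mean_avg[of "Suc k", OF zero_less_Suc]
  \<comment> \<open>Here \<open>t\<close> encodes a line, and \<open>k \<in> set t\<close> says that
    it has a wildcard.\<close>
  define good where "good t s \<longleftrightarrow> k \<in> set t \<and>
      th \<le> E (\<lambda>p. of_bool (\<forall>a<k. spread k m (collapse k a t) s \<in> A p))" for t s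
  have ex: "\<exists>t\<in>words (Suc k) n. good t s" if s: "s \<in> words (Suc k) (n * m)" for s
  proof -
    have "\<exists>l\<in>templates k 1 n. d / 2 / card (templates k 1 n)
        \<le> E (\<lambda>p. of_bool (\<forall>z\<in>words k 1. spread k m (fill l z) s \<in> A p))"
    proof (rule mean_pigeonhole[OF E])
      show "d \<le> E (\<lambda>p. avg k n (\<lambda>t. of_bool (spread k m t s \<in> A p)))"
        unfolding mean_avg_swap[OF E]
      proof (rule mean_ge_const[OF mean_avg[OF k]])
        fix t assume "t \<in> words k n"
        then show "d \<le> E (\<lambda>p. of_bool (spread k m t s \<in> A p))"
          by (intro A spread_in_words[OF _ s]) auto
      qed
      show "avg k n (\<lambda>t. of_bool (spread k m t s \<in> A p)) \<le> 1" for p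
        by (rule mean_le_const[OF mean_avg[OF k]]) simp
      show "\<exists>l\<in>templates k 1 n. \<forall>z\<in>words k 1. spread k m (fill l z) s \<in> A p"
        if "d / 2 \<le> avg k n (\<lambda>t. of_bool (spread k m t s \<in> A p))" for p
        using hj[unfolded hj_def, rule_format, of "{t. spread k m t s \<in> A p}"] that by simp
    qed (use d in auto)
    then obtain l where l: "l \<in> templates k 1 n"
      and lE: "th \<le> E (\<lambda>p. of_bool (\<forall>z\<in>words k 1. spread k m (fill l z) s \<in> A p))"
      unfolding th_def by blast
    have "fill l [k] \<in> words (Suc k) n"
      by (rule fill_in_words[OF templates_mono[OF l]]) auto
    moreover have "k \<in> set (fill l [k])"
    proof -
      have "Inr 0 \<in> set l" using l by (auto simp: templates_def)
      then show ?thesis unfolding fill_def set_map by (intro image_eqI[of _ _ "Inr 0"]) auto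
    qed
    moreover have "th \<le> E (\<lambda>p. of_bool (\<forall>a<k. spread k m (collapse k a (fill l [k])) s \<in> A p))"
    proof -
      have "collapse k a (fill l [k]) = fill l [a]" for a
        using fill_collapse[OF l, of "[k]" a] by simp
      then show ?thesis using lE by (simp only: ball_words_1)
    qed
    ultimately show ?thesis unfolding good_def by blast
  qed
  \<comment> \<open>Every \<open>s\<close> has a good \<open>t\<close>, so the pigeonhole applies
    with the constant function 1.\<close>
  have "\<exists>t\<in>words (Suc k) n. 1 / 2 / card (words (Suc k) n) \<le> avg (Suc k) (n * m) (\<lambda>s. of_bool (good t s))"
    by (rule mean_pigeonhole[OF M, where g = "\<lambda>_. 1"]) (auto simp: mean_one[OF M] ex)
  then obtain t where t: "t \<in> words (Suc k) n"
    and avg_good: "1 / 2 / Suc k ^ n \<le> avg (Suc k) (n * m) (\<lambda>s. of_bool (good t s))"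
    by (auto simp: card_words)
  have "k \<in> set t"
  proof (rule ccontr)
    assume "k \<notin> set t"
    then have "avg (Suc k) (n * m) (\<lambda>s. of_bool (good t s)) = 0"
      by (simp add: good_def mean_const[OF M])
    moreover have "(0::real) < 1 / 2 / Suc k ^ n" by (simp del: of_nat_Suc)
    ultimately show False using avg_good by linarith
  qed
  then obtain t1 t2 where t12: "t = t1 @ k # t2" using split_list by metis
  have nm: "n * m = length t1 * m + (m + length t2 * m)"
    using words_length[OF t] t12 by (auto simp: algebra_simps)
  obtain s1 where s1: "s1 \<in> words (Suc k) (length t1 * m)"
    and avg1: "1 / 2 / Suc k ^ n \<le> avg (Suc k) m (\<lambda>s. avg (Suc k) (length t2 * m) (\<lambda>s2. of_bool (good t (s1 @ s @ s2))))"
    using mean_exists_ge[OF M avg_good[unfolded nm avg_append] finite_words] by blast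
  obtain s2 where s2: "s2 \<in> words (Suc k) (length t2 * m)"
    and avg2: "1 / 2 / Suc k ^ n \<le> avg (Suc k) m (\<lambda>s. of_bool (good t (s1 @ s @ s2)))"
    using mean_exists_ge[OF M avg1[unfolded mean_avg_swap[OF M, of m]] finite_words] by blast
  obtain W where W: "W \<in> templates k (Suc m) (n * Suc m)"
    and fW: "\<And>s. s \<in> words (Suc k) m \<Longrightarrow> fill W (k # s) = spread k m t (s1 @ s @ s2)"
    using spread_subspace[OF t[unfolded t12] s1 s2] t12 by blast
  define F where "F x = E (\<lambda>p. of_bool (\<forall>a<k. fill W (collapse k a x) \<in> A p))" for x
  have F0: "0 \<le> F x" for x unfolding F_def by (rule mean_nonneg[OF E]) simp
  have Fk: "th * of_bool (good t (s1 @ s @ s2)) \<le> F (k # s)" if s: "s \<in> words (Suc k) m" for s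
  proof (cases "good t (s1 @ s @ s2)")
    case True
    have "fill W (collapse k a (k # s)) = spread k m (collapse k a t) (s1 @ s @ s2)" if "a < k" for a
      using fill_collapse[OF W, of "k # s" a] words_length[OF s] collapse_spread[of a k] that
      by (simp add: fW[OF s])
    then have "F (k # s) = E (\<lambda>p. of_bool (\<forall>a<k. spread k m (collapse k a t) (s1 @ s @ s2) \<in> A p))"
      unfolding F_def by (intro mean_cong[OF E]) (auto simp del: collapse_Cons)
    then show ?thesis using True by (simp add: good_def)
  qed (simp add: F0)
  have "th / (2 * Suc k ^ Suc n) = th * (1 / 2 / Suc k ^ n) / Suc k"
    by (simp add: algebra_simps)
  also have "\<dots> \<le> th * avg (Suc k) m (\<lambda>s. of_bool (good t (s1 @ s @ s2))) / Suc k"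
    using avg2 th by (intro divide_right_mono mult_left_mono) auto
  also have "\<dots> = avg (Suc k) m (\<lambda>s. th * of_bool (good t (s1 @ s @ s2))) / Suc k"
    by (simp only: mean_cmult[OF M])
  also have "\<dots> \<le> avg (Suc k) m (\<lambda>s. F (k # s)) / Suc k"
    by (intro divide_right_mono mean_mono[OF M] Fk) auto
  \<comment> \<open>Only parameters starting with \<open>k\<close> are known to give spread words;
    discarding the others costs the last factor \<open>Suc k\<close>.\<close>
  also have "\<dots> \<le> (\<Sum>b<Suc k. avg (Suc k) m (\<lambda>s. F (b # s))) / Suc k"
    by (intro divide_right_mono member_le_sum mean_nonneg[OF M] F0) auto
  also have "\<dots> = avg (Suc k) (Suc m) F" by (rule avg_Suc[symmetric])
  also have "\<dots> = E (\<lambda>p. avg (Suc k) (Suc m) (\<lambda>x. of_bool (\<forall>a<k. fill W (collapse k a x) \<in> A p)))"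
    unfolding F_def by (rule mean_avg_swap[OF E, symmetric])
  finally show ?thesis using W unfolding th_def by blast
qed


text \<open>If \<open>f\<close> had positive average on an \<open>n1\<close>-dimensional subspace,
  then \<open>hj\<close> would produce a line in \<open>A\<close>. Hence \<open>tiling\<close>
  bounds the integral of \<open>f\<close> over the complement of \<open>D\<close> by
  \<open>g / 2\<close>. On \<open>D\<close> itself \<open>A\<close> has density at most
  \<open>g\<close>, so \<open>f\<close> loses \<open>d + g\<close> times the density of
  \<open>D\<close>.\<close>

lemma bound_without_increment:
  assumes k: "0 < k" and g: "0 < g" "g \<le> 1" and d: "d0 \<le> d"
    and hj: "hj (Suc k) 1 (d + g) n1"
    and tiling: "\<And>D f. (\<forall>i<k. insens k i m (D i)) \<Longrightarrow> (\<forall>x\<in>words (Suc k) m. f x \<le> 1) \<Longrightarrow>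
      nonpos_on_subspaces (Suc k) n1 m {x. \<forall>i<k. x \<in> D i} f \<Longrightarrow>
      avg (Suc k) m (\<lambda>x. of_bool (\<forall>i<k. x \<in> D i) * f x) \<le> g / (2 * k)"
    and small: "(real k / Suc k) ^ m \<le> g"
    and d0: "0 < d0"
    and noline: "\<And>p. p \<in> templates (Suc k) 1 m \<Longrightarrow> \<exists>z\<in>words (Suc k) 1. fill p z \<notin> A"
  shows "avg (Suc k) m (\<lambda>x. of_bool (x \<in> A)) - d - 2 * g
    + d0 * avg (Suc k) m (\<lambda>x. of_bool (\<forall>a<k. collapse k a x \<in> A)) \<le> g / 2"
proof -
  note M = mean_avg[of "Suc k", OF zero_less_Suc]
  define f where "f x = of_bool (x \<in> A) - (d + g)" for x
  define D where "D x \<longleftrightarrow> (\<forall>a<k. collapse k a x \<in> A)" for x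
  have f1: "f x \<le> 1" for x using d d0 g by (auto simp: f_def)
  have no_increment: "avg (Suc k) n1 (\<lambda>z. f (fill q z)) \<le> 0" if q: "q \<in> templates (Suc k) n1 m" for q
  proof (rule ccontr)
    assume "\<not> ?thesis"
    then have "d + g \<le> avg (Suc k) n1 (\<lambda>z. of_bool (z \<in> {z. fill q z \<in> A}))"
      by (simp add: f_def mean_diff[OF M] mean_const[OF M])
    then obtain l where l: "l \<in> templates (Suc k) 1 n1" "\<forall>z\<in>words (Suc k) 1. fill q (fill l z) \<in> A"
      using hj unfolding hj_def by blast
    moreover have "fill (subst_template q l) z = fill q (fill l z)" for z
      using fill_subst_template[OF q, of l] l by (simp add: templates_def)
    ultimately show False using noline[OF subst_template_in_templates[OF q l(1)]] by auto
  qed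
  have piece: "avg (Suc k) m (\<lambda>x. of_bool ((\<forall>i<j. collapse k i x \<in> A) \<and> collapse k j x \<notin> A) * f x) \<le> g / (2 * k)"
    if j: "j < k" for j
  proof -
    \<comment> \<open>The complement of \<open>D\<close> is split by the least \<open>j\<close> with
      \<open>collapse k j x \<notin> A\<close>. Indices above \<open>j\<close> impose no condition,
      so that \<open>k\<close> sets are intersected as in \<open>tiling\<close>.\<close>
    define C where "C i = {x. if i < j then collapse k i x \<in> A else i = j \<longrightarrow> collapse k i x \<notin> A}" for i
    have "(\<forall>i<k. x \<in> C i) \<longleftrightarrow> (\<forall>i<j. collapse k i x \<in> A) \<and> collapse k j x \<notin> A" for x
      using j by (auto simp: C_def)
    moreover have "insens k i m (C i)" if "i < k" for i
    proof -
      have "collapse k i (collapse k i x) = collapse k i x" for x using that by (simp add: collapse_def)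
      then show ?thesis by (auto simp: insens_def C_def)
    qed
    ultimately show ?thesis
      using tiling[of C f] f1 no_increment by (simp add: nonpos_on_subspaces_def)
  qed
  have split: "(of_bool (\<not> (\<forall>i<k. P i)) :: real) = (\<Sum>j<k. of_bool ((\<forall>i<j. P i) \<and> \<not> P j))" for P :: "nat \<Rightarrow> bool" and k
  proof (induction k)
    case (Suc k)
    have "(of_bool (\<not> (\<forall>i<Suc k. P i)) :: real) = of_bool (\<not> (\<forall>i<k. P i)) + of_bool ((\<forall>i<k. P i) \<and> \<not> P k)"
      by (auto simp: less_Suc_eq)
    then show ?case using Suc by simp
  qed simp
  have "avg (Suc k) m (\<lambda>x. of_bool (\<not> D x) * f x)
      = (\<Sum>j<k. avg (Suc k) m (\<lambda>x. of_bool ((\<forall>i<j. collapse k i x \<in> A) \<and> collapse k j x \<notin> A) * f x))"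
    unfolding D_def split sum_distrib_right mean_sum[OF M] ..
  also have "\<dots> \<le> (\<Sum>j<k. g / (2 * k))" by (intro sum_mono piece) auto
  also have "\<dots> = g / 2" using k by simp
  finally have upper: "avg (Suc k) m (\<lambda>x. of_bool (\<not> D x) * f x) \<le> g / 2" .
  \<comment> \<open>If such an \<open>x\<close> contained \<open>k\<close>, the line
    \<open>wildcard k x\<close> would lie in \<open>A\<close>, its point at \<open>k\<close> being
    \<open>x\<close> itself.\<close>
  have "of_bool (D x) * of_bool (x \<in> A) \<le> (of_bool (x \<in> words k m) :: real)" if x: "x \<in> words (Suc k) m" for x
  proof (cases "D x \<and> x \<in> A")
    case True
    have "k \<notin> set x"
    proof
      assume kx: "k \<in> set x"
      have "\<forall>z\<in>words (Suc k) 1. fill (wildcard k x) z \<in> A"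
        unfolding ball_words_1 using True by (auto simp: fill_wildcard D_def less_Suc_eq)
      then show False using noline templates_mono[OF wildcard_in_templates[OF x kx], of "Suc k"] by auto
    qed
    then have "x \<in> words k m" using x by (auto simp: words_def less_Suc_eq)
    then show ?thesis by simp
  qed auto
  then have "avg (Suc k) m (\<lambda>x. of_bool (D x) * of_bool (x \<in> A)) \<le> avg (Suc k) m (\<lambda>x. of_bool (x \<in> words k m))"
    by (rule mean_mono[OF M])
  also have "\<dots> = (real k / Suc k) ^ m"
  proof -
    have "words (Suc k) m \<inter> words k m = words k m" using words_mono[of _ k m "Suc k"] by auto
    then show ?thesis by (simp add: avg_def of_bool_def sum.If_cases card_words power_divide)
  qed
  finally have DA: "avg (Suc k) m (\<lambda>x. of_bool (D x) * of_bool (x \<in> A)) \<le> g" using small by simp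
  have "avg (Suc k) m (\<lambda>x. of_bool (\<not> D x) * f x)
      = avg (Suc k) m (\<lambda>x. of_bool (x \<in> A) - (d + g) - (of_bool (D x) * of_bool (x \<in> A) - (d + g) * of_bool (D x)))"
    by (rule avg_cong) (simp add: f_def)
  also have "\<dots> = avg (Suc k) m (\<lambda>x. of_bool (x \<in> A)) - (d + g)
      - (avg (Suc k) m (\<lambda>x. of_bool (D x) * of_bool (x \<in> A)) - (d + g) * avg (Suc k) m (\<lambda>x. of_bool (D x)))"
    by (simp only: mean_diff[OF M] mean_const[OF M] mean_cmult[OF M])
  finally have eq: "avg (Suc k) m (\<lambda>x. of_bool (\<not> D x) * f x) = \<dots>" .
  have "0 \<le> avg (Suc k) m (\<lambda>x. of_bool (D x))" by (rule mean_nonneg[OF M]) simp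
  then have "d0 * avg (Suc k) m (\<lambda>x. of_bool (D x)) \<le> (d + g) * avg (Suc k) m (\<lambda>x. of_bool (D x))"
    using d g by (intro mult_right_mono) auto
  then show ?thesis using upper DA eq unfolding D_def by linarith
qed

text \<open>For a set without lines, the inequality of \<open>bound_without_increment\<close> is
  averaged over random subspaces, on which \<open>A\<close> keeps density nearly \<open>d\<close>
  and \<open>D\<close> has density at least \<open>th\<close>. As \<open>th\<close> comes from
  \<open>k\<close> and \<open>d0\<close> alone, one \<open>g\<close> works for all
  \<open>d \<ge> d0\<close>.\<close>

lemma density_increment:
  assumes k: "0 < k" and line: "\<And>d. 0 < d \<Longrightarrow> \<exists>n. hj k 1 d n" and d0: "0 < d0" "d0 \<le> 1"
  shows "\<exists>g>0. \<forall>d\<ge>d0. (\<exists>n. hj (Suc k) 1 (d + g) n) \<longrightarrow> (\<exists>n. hj (Suc k) 1 d n)"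
proof -
  note M = mean_avg[of "Suc k", OF zero_less_Suc]
  have d02: "0 < d0 / 2" "0 < d0 / 2 / 2" using d0 by auto
  obtain n0 where n0: "hj k 1 (d0 / 2 / 2) n0" using line[OF d02(2)] by blast
  define th where "th = d0 / 2 / 2 / card (templates k 1 n0) / (2 * Suc k ^ Suc n0)"
  have "templates k 1 n0 \<noteq> {}"
    using n0[unfolded hj_def, rule_format, of UNIV] d0 by (auto simp: mean_one[OF mean_avg[OF k]])
  then have "0 < card (templates k 1 n0)" by (simp add: card_gt_0_iff)
  then have th: "0 < th" unfolding th_def using d0
    by (intro divide_pos_pos) (simp_all del: of_nat_Suc power_Suc)
  \<comment> \<open>With \<open>e \<le> g\<close> below, the averaged left side is at least
    \<open>4 * g - 2 * g - e \<ge> g\<close>, which exceeds \<open>g / 2\<close>.\<close>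
  define g where "g = min 1 (d0 * th / 4)"
  have g: "0 < g" "g \<le> 1" "4 * g \<le> d0 * th" using th d0 by (auto simp: g_def)
  have "\<exists>n. hj (Suc k) 1 d n" if d: "d0 \<le> d" and n1: "hj (Suc k) 1 (d + g) n1" for d n1
  proof -
    have b: "0 < g / (2 * k)" "g / (2 * k) \<le> 1" using g k by (auto simp: pos_divide_le_eq)
    obtain m0 where m0: "\<forall>m\<ge>m0. \<forall>D f. (\<forall>i<k. insens k i m (D i)) \<longrightarrow> (\<forall>x\<in>words (Suc k) m. f x \<le> 1) \<longrightarrow>
        nonpos_on_subspaces (Suc k) n1 m {x. \<forall>i<k. x \<in> D i} f \<longrightarrow>
        avg (Suc k) m (\<lambda>x. of_bool (\<forall>i<k. x \<in> D i) * f x) \<le> g / (2 * k)"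
      by (atomize_elim, rule insens_Inter_tiling[OF line order_refl b])
    have "real k / Suc k < 1" by simp
    from real_arch_pow_inv[OF g(1) this] obtain m1 where m1: "(real k / Suc k) ^ m1 < g" by blast
    define m where "m = max m0 m1"
    have "(real k / Suc k) ^ Suc m \<le> (real k / Suc k) ^ m1"
      by (rule power_decreasing) (auto simp: m_def)
    then have small: "(real k / Suc k) ^ Suc m \<le> g" using m1 by simp
    \<comment> \<open>The bound \<open>e \<le> d0 / 2\<close> ensures that each point of the random
      subspace lies in \<open>A\<close> with probability at least \<open>d0 / 2\<close>.\<close>
    define e where "e = min g (d0 / 2)"
    have e: "0 < e" "e \<le> g" "e \<le> d0 / 2" using g d0 by (auto simp: e_def)
    define N where "N = n0 * Suc m"
    obtain n E where nE: "mean_on (templates (Suc k) N n) E \<and> (\<forall>x\<in>words (Suc k) N.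
        \<forall>g. (\<forall>w\<in>words (Suc k) n. 0 \<le> g w \<and> g w \<le> 1) \<longrightarrow> avg (Suc k) n g - e \<le> E (\<lambda>p. g (fill p x)))"
      using uniform_subspace[of "Suc k" _ N, OF zero_less_Suc e(1)] by (elim exE)
    then have E: "mean_on (templates (Suc k) N n) E" by (rule conjunct1)
    have "\<exists>p\<in>templates (Suc k) 1 n. \<forall>z\<in>words (Suc k) 1. fill p z \<in> A"
      if dA: "d \<le> avg (Suc k) n (\<lambda>w. of_bool (w \<in> A))" for A
    proof (rule ccontr)
      assume noline: "\<not> ?thesis"
      have dense: "d - e \<le> E (\<lambda>p. of_bool (fill p x \<in> A))" if "x \<in> words (Suc k) N" for x
        using nE[THEN conjunct2, rule_format, OF that, of "\<lambda>w. of_bool (w \<in> A)"] dA by simp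
      have "d0 / 2 \<le> E (\<lambda>p. of_bool (x \<in> {x. fill p x \<in> A}))" if "x \<in> words k (n0 * Suc m)" for x
        using dense[OF words_mono[OF that[folded N_def]]] d e by simp
      from dense_line_directions[OF k n0 d02(1) E this]
      obtain W where W: "W \<in> templates k (Suc m) N"
        and thE: "th \<le> E (\<lambda>p. avg (Suc k) (Suc m) (\<lambda>x. of_bool (\<forall>a<k. fill p (fill W (collapse k a x)) \<in> A)))"
        unfolding th_def N_def by auto
      have W': "W \<in> templates (Suc k) (Suc m) N" using templates_mono[OF W] by simp
      define P where "P p = avg (Suc k) (Suc m) (\<lambda>x. of_bool (fill p (fill W x) \<in> A))" for p
      define Q where "Q p = avg (Suc k) (Suc m) (\<lambda>x. of_bool (\<forall>a<k. fill p (fill W (collapse k a x)) \<in> A))" for p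
      have "P p - d - 2 * g + d0 * Q p \<le> g / 2" if p: "p \<in> templates (Suc k) N n" for p
      proof -
        have "avg (Suc k) (Suc m) (\<lambda>x. of_bool (x \<in> {x. fill p (fill W x) \<in> A})) - d - 2 * g
            + d0 * avg (Suc k) (Suc m) (\<lambda>x. of_bool (\<forall>a<k. collapse k a x \<in> {x. fill p (fill W x) \<in> A})) \<le> g / 2"
        proof (rule bound_without_increment[OF k g(1,2) d n1 _ small d0(1)])
          fix D f assume "\<forall>i<k. insens k i (Suc m) (D i)" "\<forall>x\<in>words (Suc k) (Suc m). f x \<le> 1"
            "nonpos_on_subspaces (Suc k) n1 (Suc m) {x. \<forall>i<k. x \<in> D i} f"
          then show "avg (Suc k) (Suc m) (\<lambda>x. of_bool (\<forall>i<k. x \<in> D i) * f x) \<le> g / (2 * k)"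
            using m0[THEN spec, of "Suc m"] by (simp add: m_def)
        next
          fix l assume l: "l \<in> templates (Suc k) 1 (Suc m)"
          have eq: "fill p (fill W (fill l z)) = fill (subst_template p (subst_template W l)) z" for z
            using fill_subst_template[OF p, of "subst_template W l"] fill_subst_template[OF W, of l]
              subst_template_in_templates[OF W' l] l by (simp add: templates_def)
          show "\<exists>z\<in>words (Suc k) 1. fill l z \<notin> {x. fill p (fill W x) \<in> A}"
            unfolding mem_Collect_eq eq
            using noline subst_template_in_templates[OF p subst_template_in_templates[OF W' l]] by blast
        qed
        then show ?thesis by (simp add: P_def Q_def)
      qed
      then have "E (\<lambda>p. P p - d - 2 * g + d0 * Q p) \<le> g / 2"
        by (rule mean_le_const[OF E])
      then have "E P - d - 2 * g + d0 * E Q \<le> g / 2"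
        by (simp add: mean_diff[OF E] mean_add[OF E] mean_const[OF E] mean_cmult[OF E])
      moreover have "d - e \<le> E P"
        unfolding P_def mean_avg_swap[OF E]
        by (rule mean_ge_const[OF M], rule dense, rule fill_in_words[OF W'])
      moreover have "d0 * th \<le> d0 * E Q"
        using thE d0 unfolding Q_def by (intro mult_left_mono) auto
      ultimately show False using e g by linarith
    qed
    then show ?thesis unfolding hj_def by blast
  qed
  then show ?thesis using g(1) by blast
qed

text \<open>Induction on the alphabet. Thresholds above 1 are vacuous, and finitely many steps of
  the fixed size \<open>g\<close> lead from there down to \<open>d\<close>.\<close>

theorem density_Hales_Jewett:
  assumes "0 < k" "0 < d"
  shows "\<exists>n. hj k 1 d n"
  using assms
proof (induction k arbitrary: d)
  case (Suc k)
  show ?case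
  proof (cases "k = 0")
    case True
    have w: "words 1 1 = {[0]}" unfolding words_1 by auto
    have "hj 1 1 d 1" unfolding hj_def
    proof (intro allI impI)
      fix A assume "d \<le> avg 1 1 (\<lambda>w. of_bool (w \<in> A))"
      then have "[0] \<in> A" using Suc.prems
        by (cases "[0] \<in> A") (auto simp: avg_def w simp del: One_nat_def)
      moreover have "[Inr 0] \<in> templates 1 1 1" by (auto simp: templates_def)
      ultimately show "\<exists>p\<in>templates 1 1 1. \<forall>z\<in>words 1 1. fill p z \<in> A"
        unfolding w by (intro bexI[of _ "[Inr 0]"]) (auto simp: fill_def)
    qed
    then show ?thesis using True by auto
  next
    case False
    then have k: "0 < k" by simp
    define d0 where "d0 = min d 1"
    have d0: "0 < d0" "d0 \<le> 1" using Suc.prems by (auto simp: d0_def)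
    obtain g where g: "0 < g" and inc: "\<And>d. d0 \<le> d \<Longrightarrow> \<exists>n. hj (Suc k) 1 (d + g) n \<Longrightarrow> \<exists>n. hj (Suc k) 1 d n"
      using density_increment[OF k Suc.IH[OF k] d0] by blast
    have descent: "\<exists>n. hj (Suc k) 1 d n" if "d0 \<le> d" "1 < d + real i * g" for i d
      using that
    proof (induction i arbitrary: d)
      case 0
      have "\<not> d \<le> avg (Suc k) 0 (\<lambda>w. of_bool (w \<in> A))" for A
        using 0 by (cases "[] \<in> A") auto
      then have "hj (Suc k) 1 d 0" unfolding hj_def by blast
      then show ?case by blast
    next
      case (Suc i)
      then show ?case using g by (intro inc[OF _ Suc.IH]) (auto simp: algebra_simps)
    qed
    obtain i :: nat where "1 < i * g" using ex_less_of_nat_mult[OF g] by blast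
    then show ?thesis using descent[of d i] Suc.prems by (simp add: d0_def)
  qed
qed simp


section \<open>Sets of positive upper Banach density\<close>

lemma semigroup_sum_cong:
  assumes "finite I" "I \<noteq> {}" "\<And>i. i \<in> I \<Longrightarrow> f i = g i"
  shows "semigroup_sum f I = semigroup_sum g I"
  using assms by (induction rule: finite_ne_induct) (simp_all add: semigroup_sum_insert)

lemma semigroup_sum_Un_disjoint:
  assumes "finite I" "I \<noteq> {}" "finite J" "J \<noteq> {}" "I \<inter> J = {}"
  shows "semigroup_sum f (I \<union> J) = semigroup_sum f I + semigroup_sum f J"
  using assms
proof (induction rule: finite_ne_induct)
  case (singleton i)
  then show ?case by (simp add: semigroup_sum_insert)
next
  case (insert i I)
  then have "semigroup_sum f (insert i I \<union> J) = f i + semigroup_sum f (I \<union> J)"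
    by (simp add: semigroup_sum_insert)
  then show ?case using insert by (simp add: semigroup_sum_insert add.assoc)
qed

text \<open>By invariance the sum of the shifted indicators has mean
  \<open>card W * L (indicator A)\<close>; positivity and \<open>L (\<lambda>x. 1) \<le> 1\<close>
  prevent it from staying below half of this everywhere. The half leaves room, as a supremum need
  not be attained.\<close>

lemma invariant_mean_average:
  fixes A :: "'a::ab_semigroup_add set" and p :: "'b \<Rightarrow> 'a"
  assumes L: "L \<in> invariant_means" and pos: "0 < L (indicator A)" and W: "finite W" "W \<noteq> {}"
  shows "\<exists>x. L (indicator A) / 2 \<le> (\<Sum>w\<in>W. indicator A (x + p w)) / card W"
proof (rule ccontr)
  assume *: "\<not> ?thesis"
  define d where "d = L (indicator A)"
  have bdd: "f \<in> bounded_functions \<longleftrightarrow> (\<exists>B. \<forall>x. \<bar>f x\<bar> \<le> B)" for f :: "'a \<Rightarrow> real"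
    by (auto simp: bounded_functions_def bounded_iff)
  have add: "L (\<lambda>x. f x + g x) = L f + L g" if "f \<in> bounded_functions" "g \<in> bounded_functions" for f g
    using L that by (auto simp: invariant_means_def linear_functional_def)
  have scale: "L (\<lambda>x. c * f x) = c * L f" if "f \<in> bounded_functions" for c f
    using L that by (auto simp: invariant_means_def linear_functional_def)
  have nonneg: "0 \<le> L f" if "f \<in> bounded_functions" "\<And>x. 0 \<le> f x" for f
    using L that by (auto simp: invariant_means_def positive_functional_def)
  have shift: "L (\<lambda>x. indicator A (x + s)) = d" for s
  proof -
    have "indicator A \<in> (bounded_functions :: ('a \<Rightarrow> real) set)"
      unfolding bdd by (intro exI[of _ 1]) (simp add: indicator_def)
    then have "L (\<lambda>x. indicator A (s + x)) = d"
      using L by (auto simp: invariant_means_def translation_invariant_def d_def)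
    then show ?thesis by (simp add: add.commute)
  qed
  have ind: "(\<lambda>x. indicator A (x + s)) \<in> (bounded_functions :: ('a \<Rightarrow> real) set)" for s
    unfolding bdd by (intro exI[of _ 1]) (simp add: indicator_def)
  have sums: "(\<lambda>x. \<Sum>w\<in>V. indicator A (x + p w)) \<in> (bounded_functions :: ('a \<Rightarrow> real) set) \<and>
      L (\<lambda>x. \<Sum>w\<in>V. indicator A (x + p w)) = card V * d" if "finite V" for V
    using that
  proof (induction V)
    case empty
    have "(\<lambda>x. 0) \<in> (bounded_functions :: ('a \<Rightarrow> real) set)" unfolding bdd by auto
    then show ?case using scale[of "\<lambda>x. 0" 0] by simp
  next
    case (insert w V)
    have "(\<lambda>x. indicator A (x + p w) + (\<Sum>w\<in>V. indicator A (x + p w))) \<in> (bounded_functions :: ('a \<Rightarrow> real) set)"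
    proof -
      obtain B where "\<forall>x. \<bar>\<Sum>w\<in>V. indicator A (x + p w) :: real\<bar> \<le> B" using insert.IH by (auto simp: bdd)
      then have "\<bar>indicator A (x + p w) + (\<Sum>w\<in>V. indicator A (x + p w)) :: real\<bar> \<le> 1 + B" for x
        by (intro order_trans[OF abs_triangle_ineq] add_mono) (auto simp: indicator_def)
      then show ?thesis unfolding bdd by blast
    qed
    moreover have "L (\<lambda>x. indicator A (x + p w) + (\<Sum>w\<in>V. indicator A (x + p w))) = d + card V * d"
      using add[OF ind] insert.IH shift by simp
    ultimately show ?case using insert.hyps by (simp add: algebra_simps)
  qed
  have const: "(\<lambda>x. c) \<in> (bounded_functions :: ('a \<Rightarrow> real) set)" for c
    unfolding bdd by auto
  have "L (\<lambda>x. 1) \<le> 1"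
  proof -
    have "ereal \<bar>L (\<lambda>x. 1)\<bar> \<le> functional_norm L"
      unfolding functional_norm_def using const[of 1] by (intro SUP_upper) auto
    also have "\<dots> = 1" using L by (simp add: invariant_means_def)
    finally show ?thesis by (simp add: one_ereal_def)
  qed
  define S where "S x = (\<Sum>w\<in>W. indicator A (x + p w) :: real)" for x
  have S: "S \<in> bounded_functions" "L S = card W * d"
    using sums[OF W(1)] unfolding S_def by auto
  have card: "0 < real (card W)" using W by (simp add: card_gt_0_iff)
  have le: "S x \<le> card W * d / 2" for x
    using *[unfolded not_ex, THEN spec, of x] card by (simp add: S_def d_def field_simps)
  have neg: "(\<lambda>x. - 1 * S x) \<in> bounded_functions" using S(1) unfolding bdd by simp
  have "(\<lambda>x. card W * d / 2 * 1 + - 1 * S x) \<in> bounded_functions"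
  proof -
    obtain B where "\<forall>x. \<bar>S x\<bar> \<le> B" using S(1) by (auto simp: bdd)
    then have "\<bar>card W * d / 2 * 1 + - 1 * S x\<bar> \<le> \<bar>card W * d / 2\<bar> + B" for x
      by (intro order_trans[OF abs_triangle_ineq] add_mono) auto
    then show ?thesis unfolding bdd by blast
  qed
  then have "0 \<le> L (\<lambda>x. card W * d / 2 * 1 + - 1 * S x)"
    using le by (intro nonneg) auto
  also have "\<dots> = card W * d / 2 * L (\<lambda>x. 1) - card W * d"
    using add[OF _ neg, of "\<lambda>x. card W * d / 2 * 1"] scale[OF const[of 1], of "card W * d / 2"]
      scale[OF S(1), of "- 1"] S(2) const by simp
  also have "\<dots> \<le> card W * d / 2 * 1 - card W * d"
    using \<open>L (\<lambda>x. 1) \<le> 1\<close> card pos by (intro diff_right_mono mult_left_mono) (auto simp: d_def)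
  finally show False using card pos by (simp add: d_def mult_le_0_iff)
qed

theorem theorem3p3:
  fixes A :: "'a::ab_semigroup_add set"
  assumes "upper_Banach_density A > 0"
  shows "combinatorially_rich A"
  unfolding combinatorially_rich_def
proof
  fix n :: nat
  obtain L where L: "L \<in> invariant_means" and pos: "0 < L (indicator A)"
    using assms by (auto simp: upper_Banach_density_def less_SUP_iff zero_ereal_def)
  define d where "d = L (indicator A) / 2"
  have d: "0 < d" using pos by (simp add: d_def)
  show "\<exists>r. \<forall>M :: nat \<Rightarrow> nat \<Rightarrow> 'a. \<exists>\<alpha> s. \<alpha> \<noteq> {} \<and> \<alpha> \<subseteq> {1..r} \<and>
      (\<forall>j\<in>{1..n}. s + semigroup_sum (\<lambda>i. M i j) \<alpha> \<in> A)"
  proof (cases "n = 0")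
    case True
    \<comment> \<open>Without columns only a nonempty \<open>\<alpha>\<close> is asked for, so
      \<open>r = 1\<close> suffices.\<close>
    then show ?thesis by (intro exI[of _ 1] allI exI[of _ "{1}"]) simp
  next
    case False
    then have n: "0 < n" by simp
    obtain r where r: "hj n 1 d r" using density_Hales_Jewett[OF n d] by blast
    have "\<exists>\<alpha> s. \<alpha> \<noteq> {} \<and> \<alpha> \<subseteq> {1..r} \<and> (\<forall>j\<in>{1..n}. s + semigroup_sum (\<lambda>i. M i j) \<alpha> \<in> A)"
      for M :: "nat \<Rightarrow> nat \<Rightarrow> 'a"
    proof -
      \<comment> \<open>Positions and letters of words count from 0, rows and columns of
        \<open>M\<close> from 1: row \<open>i\<close> reads position \<open>i - 1\<close>, and
        letter \<open>a\<close> selects column \<open>Suc a\<close>.\<close>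
      define p where "p w = semigroup_sum (\<lambda>i. M i (Suc (w ! (i - 1)))) {1..r}" for w
      have "words n r \<noteq> {}" using mean_nonempty[OF mean_avg[OF n]] .
      then obtain x where x: "d \<le> (\<Sum>w\<in>words n r. indicator A (x + p w)) / card (words n r)"
        using invariant_mean_average[OF L pos finite_words, of n r p] unfolding d_def by blast
      then have "d \<le> avg n r (\<lambda>w. of_bool (w \<in> {w. x + p w \<in> A}))"
        by (simp add: avg_def card_words indicator_def of_bool_def)
      then obtain l where l: "l \<in> templates n 1 r" and lA: "\<And>a. a < n \<Longrightarrow> x + p (fill l [a]) \<in> A"
        using r[unfolded hj_def, rule_format] unfolding ball_words_1 by blast
      define I where "I = {i\<in>{1..r}. l ! (i - 1) = Inr 0}"
      define J where "J = {1..r} - I"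
      \<comment> \<open>This is used on \<open>J\<close>, where the template is constant, so the
        inserted letter 0 is arbitrary.\<close>
      define c where "c i = M i (Suc (fill l [0] ! (i - 1)))" for i
      have len: "length l = r" using l by (simp add: templates_def)
      have "Inr 0 \<in> set l" using l by (auto simp: templates_def)
      then obtain i where "i < r" "l ! i = Inr 0" using len by (auto simp: in_set_conv_nth)
      then have I: "I \<noteq> {}" "finite I" "I \<subseteq> {1..r}"
        by (auto simp: I_def intro!: exI[of _ "Suc i"])
      have J: "finite J" "I \<inter> J = {}" "{1..r} = I \<union> J" using I by (auto simp: J_def)
      have fillI: "fill l [a] ! (i - 1) = a" if "i \<in> I" for i a
        using that len by (auto simp: I_def fill_def)
      have fillJ: "fill l [a] ! (i - 1) = fill l [0] ! (i - 1)" if "i \<in> J" for i a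
      proof -
        have i: "i - 1 < length l" and ne: "l ! (i - 1) \<noteq> Inr 0"
          using that len by (auto simp: J_def I_def)
        have "l ! (i - 1) \<in> Inl ` {..<n} \<union> Inr ` {..<1}"
          using l nth_mem[OF i] unfolding templates_def by blast
        then show ?thesis using i ne by (auto simp: fill_def)
      qed
      \<comment> \<open>With no neutral element to serve as an empty sum, an empty \<open>J\<close>
        is a separate case.\<close>
      define s where "s = (if J = {} then x else x + semigroup_sum c J)"
      have "s + semigroup_sum (\<lambda>i. M i j) I \<in> A" if j: "j \<in> {1..n}" for j
      proof -
        \<comment> \<open>The point of the line at letter \<open>j - 1\<close> takes column
          \<open>j\<close> in all the wildcard rows \<open>I\<close>.\<close>
        define f where "f i = M i (Suc (fill l [j - 1] ! (i - 1)))" for i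
        have fI: "semigroup_sum f I = semigroup_sum (\<lambda>i. M i j) I"
          using I j by (intro semigroup_sum_cong) (simp_all add: f_def fillI del: One_nat_def)
        have "x + semigroup_sum f {1..r} = s + semigroup_sum (\<lambda>i. M i j) I"
        proof (cases "J = {}")
          case True
          then show ?thesis using J fI by (simp add: s_def)
        next
          case False
          have "semigroup_sum f J = semigroup_sum c J"
            using J False fillJ[of _ "j - 1"] by (intro semigroup_sum_cong) (auto simp: f_def c_def)
          then show ?thesis
            using semigroup_sum_Un_disjoint[OF I(2,1) J(1) False J(2), of f] J(3) fI False
            by (simp add: s_def ac_simps)
        qed
        moreover have "x + semigroup_sum f {1..r} \<in> A"
          using lA[of "j - 1"] j unfolding p_def f_def[abs_def] by auto
        ultimately show ?thesis by simp
      qed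
      then show ?thesis using I by blast
    qed
    then show ?thesis by blast
  qed
qed

end
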